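(* Let $f(\mathbf z,\bar{\mathbf z})$ be a strongly non-degenerate mixed polynomial in $n$ complex variables which is locally tame along its vanishing coordinate subspaces. Then the (open ball) Milnor fibration of $f$ satisfies the stable boundary condition; that is, for every sufficiently small $r>0$ and every $\theta\in\mathbb R$, $$\overline{F_{\theta,\le r}}\supset V\cap B_r,\qquad F_{\theta,\le r}=\{\mathbf z\in B_r\setminus V: f(\mathbf z,\bar{\mathbf z})/|f(\mathbf z,\bar{\mathbf z})|=e^{i\theta}\},$$ where $V=f^{-1}(0)$ and $B_r$ is the open ball of radius $r$ centered at the origin of $\mathbb C^n$.
   Context: A mixed polynomial is a finite sum $f(\mathbf z,\bar{\mathbf z})=\sum_{\nu,\mu}c_{\nu\mu}\mathbf z^\nu\bar{\mathbf z}^\mu$ with $\mathbf z\in\mathbb C^n$, $\nu,\mu\in\mathbb Z_{\ge0}^n$, viewed as a real analytic map $f:\mathbb C^n=\mathbb R^{2n}\to\mathbb C=\mathbb R^2$. A critical point of such a map is a point where the real differential has rank $<2$. The open ball Milnor fibration is $\varphi_{\le r}=f/|f|:B_r\setminus V\to S^1$, with fibers $F_{\theta,\le r}=\varphi_{\le r}^{-1}(e^{i\theta})$. For $I\subset\{1,\dots,n\}$: $\mathbb C^I=\{\mathbf z: z_j=0\ \forall j\notin I\}$, $\mathbb C^{*I}=\{\mathbf z\in\mathbb C^I: z_j\ne0\ \forall j\in I\}$, $\mathbb C^{*n}=(\mathbb C\setminus\{0\})^n$, $f^I=f|_{\mathbb C^I}$, $I^c$ is the complement. $\mathcal I_v(f)=\{I\neq\emptyset: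 f^I\equiv0\}$. For $I\in\mathcal I_v(f)$, $\mathbb C^I$ is called a vanishing coordinate subspace. Newton boundary: $\Gamma_+(f)$ is the convex hull of $\bigcup_{c_{\nu\mu}\ne0}(\nu+\mu+\mathbb R_{\ge0}^n)$, and $\Gamma(f)$ is the union of its compact faces. For a non-negative weight vector $P={}^t(p_1,\dots,p_n)$ let $d(P)$ be the minimum of $\xi\mapsto\sum p_i\xi_i$ on $\Gamma_+(f)$, $\Delta(P)$ the face where it is attained, and $I(P)=\{i: p_i=0\}$. A non-compact face $\Xi$ of $\Gamma_+(f)$ is essential if there is a non-negative weight $P$ with $\Delta(P)=\Xi$, $f^{I(P)}\equiv0$, and $\nu+\mathbb R_{\ge0}E_i\subset\Xi$ for all $i\in I(P)$, $\nu\in\Xi$ ($E_i$ the $i$-th unit vector). $I(P)$ depends only on $\Xi$ and is denoted $I(\Xi)$. $\Gamma_{nc}(f)$ is $\Gamma(f)$ together with all essential non-compact faces. For a face $\Delta$, $f_\Delta=\sum_{\nu+\mu\in\Delta}c_{\nu\mu}\mathbf z^\nu\bar{\mathbf z}^\mu$. $f$ is strongly non-degenerate if (i) for every compact face $\Delta\subset\Gamma_{nc}(f)$, $f_\Delta:\mathbb C^{*n}\to\mathbb C$ has no critical point, and (ii) for every non-compact face $\Delta\in\Gamma_{nc}(f)$, $f_{\Delta_0}:\mathbb C^{*n}\to\mathbb C$ has no critical point, where $\Delta_0=\Delta\cap\Gamma(f)$. Local tameness: for an essential non-compact face $\Delta$ put $\rho_\Delta(\mathbf z)=\sum_{j\in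 I(\Delta)}|z_j|^2$ and $V_\Delta^*=f_\Delta^{-1}(0)\cap\mathbb C^{*n}$. $f_\Delta$ is locally tame if there is $r_\Delta>0$ such that for any fixed nonzero values $z_j\ (j\in I(\Delta))$ with $\rho_\Delta(\mathbf z)\le r_\Delta^2$, $f_\Delta$, as a mixed polynomial function of the remaining variables $\{z_k: k\notin I(\Delta)\}$, has no critical points in $\mathbb C^{*I(\Delta)^c}$; moreover $r_\Delta$ is chosen (possible, after shrinking, because $f$ is a polynomial) so that $\rho_\Delta|_{V_\Delta^*}$ has no critical value in $(0,r_\Delta^2]$. $f$ is locally tame on $\mathbb C^I$ if every $f_\Delta$ with $\Delta$ essential non-compact and $I(\Delta)=I$ is locally tame; $f$ is locally tame along vanishing coordinate subspaces if this holds for every $I\in\mathcal I_v(f)$. *)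

theory Defs
  imports "HOL-Analysis.Analysis" "HOL-Library.Poly_Mapping"
begin

text \<open>The key \<open>(\<nu>, \<mu>)\<close> stands for the mixed monomial with exponent \<open>\<nu>\<close> in the variables and
  exponent \<open>\<mu>\<close> in their conjugates.\<close>

type_synonym 'n mixed_poly = "((nat, 'n) vec \<times> (nat, 'n) vec) \<Rightarrow>\<^sub>0 complex"

definition mixed_monom :: "nat ^ 'n \<Rightarrow> nat ^ 'n \<Rightarrow> complex ^ 'n \<Rightarrow> complex" where
  "mixed_monom \<nu> \<mu> z = (\<Prod>j\<in>UNIV. (z $ j) ^ (\<nu> $ j)) * (\<Prod>j\<in>UNIV. (cnj (z $ j)) ^ (\<mu> $ j))"

definition mixed_eval :: "'n::finite mixed_poly \<Rightarrow> complex ^ 'n \<Rightarrow> complex" where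
  "mixed_eval f z =
     (\<Sum>(\<nu>, \<mu>)\<in>Poly_Mapping.keys f. Poly_Mapping.lookup f (\<nu>, \<mu>) * mixed_monom \<nu> \<mu> z)"

definition total_exponent :: "nat ^ 'n \<Rightarrow> nat ^ 'n \<Rightarrow> real ^ 'n" where
  "total_exponent \<nu> \<mu> = (\<chi> j. real (\<nu> $ j + \<mu> $ j))"

text \<open>The function \<open>f\<^sub>\<Delta>\<close>; \<open>\<Delta>\<close> may be any set of points, not only a face.\<close>

definition mixed_part :: "'n::finite mixed_poly \<Rightarrow> (real ^ 'n) set \<Rightarrow> complex ^ 'n \<Rightarrow> complex" where
  "mixed_part f \<Delta> z =
     (\<Sum>(\<nu>, \<mu>)\<in>{(\<nu>, \<mu>) \<in> Poly_Mapping.keys f. total_exponent \<nu> \<mu> \<in> \<Delta>}.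
        Poly_Mapping.lookup f (\<nu>, \<mu>) * mixed_monom \<nu> \<mu> z)"

definition coord_subspace :: "'n set \<Rightarrow> (complex ^ 'n) set" where
  "coord_subspace I = {z. \<forall>j. j \<notin> I \<longrightarrow> z $ j = 0}"

definition coord_torus :: "'n set \<Rightarrow> (complex ^ 'n) set" where
  "coord_torus I = {z \<in> coord_subspace I. \<forall>j\<in>I. z $ j \<noteq> 0}"

definition vanishes_on :: "'n::finite mixed_poly \<Rightarrow> 'n set \<Rightarrow> bool" where
  "vanishes_on f I \<longleftrightarrow> (\<forall>z\<in>coord_subspace I. mixed_eval f z = 0)"

definition vanishing_sets :: "'n::finite mixed_poly \<Rightarrow> 'n set set" where
  "vanishing_sets f = {I. I \<noteq> {} \<and> vanishes_on f I}"

text \<open>\<open>critical_in J g z\<close>: the restriction of \<open>g\<close> to the coordinate subspace of \<open>J\<close> has real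
  differential of rank less than 2 at the point \<open>z\<close> of that subspace.  The differential of the
  restriction is the restriction of the differential of \<open>g\<close>.  All functions to which this is
  applied are polynomial in the real coordinates, hence differentiable.\<close>

definition critical_in :: "'n::finite set \<Rightarrow> (complex ^ 'n \<Rightarrow> complex) \<Rightarrow> complex ^ 'n \<Rightarrow> bool" where
  "critical_in J g z \<longleftrightarrow> dim (frechet_derivative g (at z) ` coord_subspace J) < 2"

abbreviation critical_point :: "(complex ^ 'n::finite \<Rightarrow> complex) \<Rightarrow> complex ^ 'n \<Rightarrow> bool" where
  "critical_point \<equiv> critical_in UNIV"

definition newton_polyhedron :: "'n::finite mixed_poly \<Rightarrow> (real ^ 'n) set" where
  "newton_polyhedron f = convex hull
     (\<Union>(\<nu>, \<mu>)\<in>Poly_Mapping.keys f. {total_exponent \<nu> \<mu> + \<eta> | \<eta>. \<forall>j. 0 \<le> \<eta> $ j})"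

definition newton_boundary :: "'n::finite mixed_poly \<Rightarrow> (real ^ 'n) set" where
  "newton_boundary f = \<Union>{\<Delta>. \<Delta> face_of newton_polyhedron f \<and> compact \<Delta>}"

text \<open>The face on which the linear form given by the weight \<open>P\<close> attains its minimum.\<close>

definition weight_face :: "'n::finite mixed_poly \<Rightarrow> real ^ 'n \<Rightarrow> (real ^ 'n) set" where
  "weight_face f P =
     {\<xi> \<in> newton_polyhedron f. \<forall>\<eta>\<in>newton_polyhedron f. P \<bullet> \<xi> \<le> P \<bullet> \<eta>}"

definition weight_zeros :: "real ^ 'n \<Rightarrow> 'n set" where
  "weight_zeros P = {i. P $ i = 0}"

text \<open>\<open>essential_face f \<Xi> I\<close>: the face \<open>\<Xi>\<close> is non-compact and essential, and \<open>I(\<Xi>) = I\<close>.  Carrying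
  the index set along avoids a definite description; it is determined by \<open>\<Xi>\<close>.\<close>

definition essential_face :: "'n::finite mixed_poly \<Rightarrow> (real ^ 'n) set \<Rightarrow> 'n set \<Rightarrow> bool" where
  "essential_face f \<Xi> I \<longleftrightarrow> \<not> compact \<Xi> \<and>
     (\<exists>P. (\<forall>i. 0 \<le> P $ i) \<and> weight_face f P = \<Xi> \<and> weight_zeros P = I \<and> vanishes_on f I \<and>
        (\<forall>i\<in>I. \<forall>\<nu>\<in>\<Xi>. \<forall>t\<ge>0. \<nu> + t *\<^sub>R axis i 1 \<in> \<Xi>))"

definition newton_boundary_nc :: "'n::finite mixed_poly \<Rightarrow> (real ^ 'n) set" where
  "newton_boundary_nc f = newton_boundary f \<union> \<Union>{\<Xi>. \<exists>I. essential_face f \<Xi> I}"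

text \<open>The library counts the empty set as a face of every convex set, so it has to be excluded
  below.\<close>

definition strongly_nondegenerate :: "'n::finite mixed_poly \<Rightarrow> bool" where
  "strongly_nondegenerate f \<longleftrightarrow>
     (\<forall>\<Delta>. \<Delta> face_of newton_polyhedron f \<and> \<Delta> \<noteq> {} \<and> compact \<Delta> \<and> \<Delta> \<subseteq> newton_boundary_nc f \<longrightarrow>
        (\<forall>z\<in>coord_torus UNIV. \<not> critical_point (mixed_part f \<Delta>) z)) \<and>
     (\<forall>\<Delta> I. essential_face f \<Delta> I \<longrightarrow>
        (\<forall>z\<in>coord_torus UNIV. \<not> critical_point (mixed_part f (\<Delta> \<inter> newton_boundary f)) z))"

definition partial_norm_sq :: "'n::finite set \<Rightarrow> complex ^ 'n \<Rightarrow> real" where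
  "partial_norm_sq I z = (\<Sum>j\<in>I. (cmod (z $ j))\<^sup>2)"

text \<open>In \<open>locally_tame_face f \<Delta> I\<close> the point \<open>w\<close> carries the fixed values of the variables in
  \<open>I = I(\<Delta>)\<close> and \<open>u\<close> the remaining variables.  The second clause says that \<open>partial_norm_sq I\<close>
  restricted to the zero set of \<open>f\<^sub>\<Delta>\<close> in the torus has no critical value in \<open>(0, r\<^sup>2]\<close>: by the
  first clause this zero set is smooth where \<open>partial_norm_sq I z \<le> r\<^sup>2\<close>, with tangent space the
  kernel of the differential of \<open>f\<^sub>\<Delta>\<close>.\<close>

definition locally_tame_face :: "'n::finite mixed_poly \<Rightarrow> (real ^ 'n) set \<Rightarrow> 'n set \<Rightarrow> bool" where
  "locally_tame_face f \<Delta> I \<longleftrightarrow> (\<exists>r>0.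
     (\<forall>w\<in>coord_torus I. partial_norm_sq I w \<le> r\<^sup>2 \<longrightarrow>
        (\<forall>u\<in>coord_torus (- I). \<not> critical_in (- I) (\<lambda>u. mixed_part f \<Delta> (w + u)) u)) \<and>
     \<not> (\<exists>z\<in>coord_torus UNIV. mixed_part f \<Delta> z = 0 \<and> partial_norm_sq I z \<in> {0<..r\<^sup>2} \<and>
        (\<forall>v. frechet_derivative (mixed_part f \<Delta>) (at z) v = 0 \<longrightarrow>
             frechet_derivative (partial_norm_sq I) (at z) v = 0)))"

definition locally_tame_on :: "'n::finite mixed_poly \<Rightarrow> 'n set \<Rightarrow> bool" where
  "locally_tame_on f I \<longleftrightarrow> (\<forall>\<Delta>. essential_face f \<Delta> I \<longrightarrow> locally_tame_face f \<Delta> I)"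

definition locally_tame_along_vanishing :: "'n::finite mixed_poly \<Rightarrow> bool" where
  "locally_tame_along_vanishing f \<longleftrightarrow> (\<forall>I\<in>vanishing_sets f. locally_tame_on f I)"

definition zero_locus :: "'n::finite mixed_poly \<Rightarrow> (complex ^ 'n) set" where
  "zero_locus f = {z. mixed_eval f z = 0}"

definition milnor_fiber :: "'n::finite mixed_poly \<Rightarrow> real \<Rightarrow> real \<Rightarrow> (complex ^ 'n) set" where
  "milnor_fiber f \<theta> r =
     {z \<in> ball 0 r - zero_locus f.
        mixed_eval f z / complex_of_real (cmod (mixed_eval f z)) = exp (\<i> * complex_of_real \<theta>)}"

definition stable_boundary_condition :: "'n::finite mixed_poly \<Rightarrow> bool" where
  "stable_boundary_condition f \<longleftrightarrow>
     (\<exists>r\<^sub>0>0. \<forall>r. 0 < r \<and> r \<le> r\<^sub>0 \<longrightarrow>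
        (\<forall>\<theta>. zero_locus f \<inter> ball 0 r \<subseteq> closure (milnor_fiber f \<theta> r)))"

end

theory Submission
  imports Defs
begin

text \<open>Why the theorem holds.  Every point \<open>a\<close> of the zero locus lies in exactly one torus
  \<open>coord_torus I\<close>, where \<open>I\<close> is the set of its nonzero coordinates.  It suffices to show that, for
  \<open>a\<close> close enough to the origin, \<open>f\<close> attains positive multiples of every unit complex number \<open>v\<close>
  arbitrarily close to \<open>a\<close> (\<open>attains_directions_near\<close>): these points lie in the Milnor fibre of
  angle \<open>\<theta>\<close> when \<open>v = exp (\<i> \<theta>)\<close>.  There are two situations.

  If \<open>f\<close> does not vanish identically on the coordinate subspace of \<open>I\<close>, the restriction of \<open>f\<close> has
  no critical point in the torus near the origin, hence is open at \<open>a\<close>.  This is a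
  consequence of non-degeneracy.  Were there critical points \<open>b\<^sub>k\<close> tending to \<open>0\<close>, one would normalise the
  moduli of the monomials at \<open>b\<^sub>k\<close> to have sum \<open>1\<close> and pass to a convergent subsequence.  The
  monomials with nonzero limit are exactly those minimising some strictly positive weight, and the
  points \<open>b\<^sub>k\<close>, rescaled along weights with that face, converge in the torus to a critical point of the
  corresponding face function (\<open>limiting_weight\<close>, \<open>no_critical_point_near_zero\<close>).  The argument
  uses compactness alone and replaces the curve selection lemma.

  If \<open>f\<close> vanishes identically on that subspace, or \<open>a = 0\<close>, one chooses a weight \<open>P\<close> with zero set
  \<open>I\<close> that is generic in the sense that all minimal monomials have the same total exponent outside
  \<open>I\<close> (\<open>adapted_weight\<close>).  The face function \<open>g\<close> with the \<open>I\<close>-variables frozen at \<open>a\<close> has no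
  critical point, by local tameness if \<open>I \<noteq> {}\<close> and by non-degeneracy if \<open>I = {}\<close>.  So its image is
  open.  By genericity \<open>g\<close> equals a positive function of the moduli times a function on a compact
  torus, so the cone over the image is also closed away from \<open>0\<close>.  By connectedness every
  direction is attained (\<open>slice_attains_every_direction\<close>).  Finally \<open>f\<close>, evaluated along the weighted
  curves \<open>t\<^sup>P z\<close> and divided by the leading power of \<open>t\<close>, is a deformation of the face function
  at \<open>t = 0\<close>, and an open mapping argument in the variables \<open>(t, z)\<close> transfers the direction from
  the face function to \<open>f\<close> at small \<open>t > 0\<close> (\<open>direction_attained_near\<close>).\<close>

section \<open>Sums of mixed monomials and their logarithmic differentials\<close>

abbreviation monomial :: "(nat ^ 'n) \<times> (nat ^ 'n) \<Rightarrow> complex ^ 'n::finite \<Rightarrow> complex" where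
  "monomial \<kappa> \<equiv> mixed_monom (fst \<kappa>) (snd \<kappa>)"

abbreviation exponent :: "(nat ^ 'n) \<times> (nat ^ 'n) \<Rightarrow> real ^ 'n" where
  "exponent \<kappa> \<equiv> total_exponent (fst \<kappa>) (snd \<kappa>)"

text \<open>Restrictions of a mixed polynomial to faces and to coordinate subspaces all arise by discarding
  monomials.  Keeping the coefficients fixed and varying the finite set of keys treats them
  uniformly.\<close>

definition key_sum ::
  "((nat ^ 'n) \<times> (nat ^ 'n) \<Rightarrow> complex) \<Rightarrow> ((nat ^ 'n) \<times> (nat ^ 'n)) set
     \<Rightarrow> complex ^ 'n::finite \<Rightarrow> complex" where
  "key_sum c K z = (\<Sum>\<kappa>\<in>K. c \<kappa> * monomial \<kappa> z)"

lemma mixed_eval_eq_key_sum: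
  "mixed_eval f = key_sum (Poly_Mapping.lookup f) (Poly_Mapping.keys f)"
  by (rule ext) (simp add: mixed_eval_def key_sum_def case_prod_beta)

lemma mixed_part_eq_key_sum:
  "mixed_part f \<Delta> = key_sum (Poly_Mapping.lookup f) {\<kappa> \<in> Poly_Mapping.keys f. exponent \<kappa> \<in> \<Delta>}"
proof (rule ext)
  fix z
  have "{(\<nu>, \<mu>). (\<nu>, \<mu>) \<in> Poly_Mapping.keys f \<and> total_exponent \<nu> \<mu> \<in> \<Delta>} =
      {\<kappa> \<in> Poly_Mapping.keys f. exponent \<kappa> \<in> \<Delta>}" by auto
  then show "mixed_part f \<Delta> z =
      key_sum (Poly_Mapping.lookup f) {\<kappa> \<in> Poly_Mapping.keys f. exponent \<kappa> \<in> \<Delta>} z"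
    by (simp add: mixed_part_def key_sum_def case_prod_beta)
qed

text \<open>The action of the positive real torus in logarithmic coordinates: monomials are eigenfunctions, with
  eigenvalue given by pairing \<open>q\<close> with the total exponent.  Weighted curves, polar coordinates and
  the limit argument below all use this action.\<close>

definition rescale :: "real ^ 'n \<Rightarrow> complex ^ 'n \<Rightarrow> complex ^ 'n::finite" where
  "rescale q z = (\<chi> j. of_real (exp (q $ j)) * z $ j)"

lemma monomial_rescale:
  "monomial \<kappa> (rescale q z) = of_real (exp (q \<bullet> exponent \<kappa>)) * monomial \<kappa> z"
proof -
  have "exp (q \<bullet> exponent \<kappa>) = (\<Prod>j\<in>UNIV. exp (q $ j) ^ (fst \<kappa> $ j) * exp (q $ j) ^ (snd \<kappa> $ j))"
    by (simp add: inner_vec_def exp_sum total_exponent_def exp_of_nat_mult[symmetric] 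
        exp_add[symmetric] algebra_simps)
  then show ?thesis
    by (simp add: mixed_monom_def rescale_def power_mult_distrib prod.distrib mult_ac)
qed

lemma continuous_on_monomial:
  "continuous_on S (monomial \<kappa>)"
  unfolding mixed_monom_def by (intro continuous_intros)

lemma continuous_on_key_sum: "continuous_on S (key_sum c K)"
  unfolding key_sum_def by (intro continuous_intros continuous_on_monomial)

lemma key_sum_cong:
  assumes "\<And>\<kappa> j. \<kappa> \<in> K \<Longrightarrow> z $ j \<noteq> z' $ j \<Longrightarrow> exponent \<kappa> $ j = 0"
  shows "key_sum c K z = key_sum c K z'"
proof -
  have "monomial \<kappa> z = monomial \<kappa> z'" if "\<kappa> \<in> K" for \<kappa>
  proof -
    have "(z $ j) ^ (fst \<kappa> $ j) = (z' $ j) ^ (fst \<kappa> $ j) \<and>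
        (cnj (z $ j)) ^ (snd \<kappa> $ j) = (cnj (z' $ j)) ^ (snd \<kappa> $ j)" for j
    proof (cases "z $ j = z' $ j")
      case False
      then have "real (fst \<kappa> $ j + snd \<kappa> $ j) = 0"
        using assms[OF that, of j] by (simp add: total_exponent_def)
      then have "fst \<kappa> $ j = 0" "snd \<kappa> $ j = 0" by linarith+
      then show ?thesis by simp
    qed simp
    then show ?thesis by (simp add: mixed_monom_def)
  qed
  then show ?thesis by (simp add: key_sum_def)
qed

text \<open>The differential of the logarithm of a monomial, in the coordinates \<open>\<eta>\<^sub>j = \<zeta>\<^sub>j / z\<^sub>j\<close>.  In these
  coordinates it is independent of the base point, which is what lets critical points be
  rescaled and passed to the limit.\<close>

definition log_diff :: "(nat ^ 'n) \<times> (nat ^ 'n) \<Rightarrow> complex ^ 'n::finite \<Rightarrow> complex" where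
  "log_diff \<kappa> \<eta> = (\<Sum>j\<in>UNIV. of_nat (fst \<kappa> $ j) * \<eta> $ j + of_nat (snd \<kappa> $ j) * cnj (\<eta> $ j))"

lemma has_derivative_monomial:
  fixes z :: "complex ^ 'n::finite"
  assumes z: "z \<in> coord_torus UNIV"
  shows "(monomial \<kappa> has_derivative (\<lambda>\<zeta>. monomial \<kappa> z * log_diff \<kappa> (\<chi> j. \<zeta> $ j / z $ j))) (at z)"
proof -
  have nz: "z $ j \<noteq> 0" for j using z by (auto simp: coord_torus_def)
  note D = bounded_linear_imp_has_derivative[OF bounded_linear_vec_nth]
  note DC = bounded_linear_imp_has_derivative[OF bounded_linear_compose[OF bounded_linear_cnj bounded_linear_vec_nth]]
  have prod1: "(\<Prod>i\<in>UNIV - {j}. g i) = (\<Prod>i\<in>UNIV. g i) / g j" if "g j \<noteq> 0" for g :: "'n \<Rightarrow> complex" and j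
    using that by (simp add: prod.remove[of UNIV j])
  have A1: "((\<lambda>z. (z $ j) ^ n) has_derivative (\<lambda>\<zeta>. (z $ j) ^ n * (of_nat n * (\<zeta> $ j / z $ j)))) (at z)" for n j
    using nz[of j] by (intro has_derivative_eq_rhs[OF has_derivative_power[OF D]])
       (cases n; simp add: fun_eq_iff mult_ac)
  have B1: "((\<lambda>z. (cnj (z $ j)) ^ n) has_derivative
      (\<lambda>\<zeta>. (cnj (z $ j)) ^ n * (of_nat n * cnj (\<zeta> $ j / z $ j)))) (at z)" for n j
    using nz[of j] by (intro has_derivative_eq_rhs[OF has_derivative_power[OF DC]])
       (cases n; simp add: fun_eq_iff mult_ac)
  have A: "((\<lambda>z. \<Prod>j\<in>UNIV. (z $ j) ^ n j) has_derivative
      (\<lambda>\<zeta>. (\<Prod>j\<in>UNIV. (z $ j) ^ n j) * (\<Sum>j\<in>UNIV. of_nat (n j) * (\<zeta> $ j / z $ j)))) (at z)" for n :: "'n \<Rightarrow> nat"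
    by (rule has_derivative_eq_rhs, rule has_derivative_prod, rule A1)
       (simp add: fun_eq_iff prod1 nz sum_distrib_left mult_ac)
  have B: "((\<lambda>z. \<Prod>j\<in>UNIV. (cnj (z $ j)) ^ n j) has_derivative
      (\<lambda>\<zeta>. (\<Prod>j\<in>UNIV. (cnj (z $ j)) ^ n j) * (\<Sum>j\<in>UNIV. of_nat (n j) * cnj (\<zeta> $ j / z $ j)))) (at z)" for n :: "'n \<Rightarrow> nat"
    by (rule has_derivative_eq_rhs, rule has_derivative_prod, rule B1)
       (simp add: fun_eq_iff prod1 nz sum_distrib_left mult_ac)
  show ?thesis
    unfolding mixed_monom_def
    by (rule has_derivative_eq_rhs, rule has_derivative_mult[OF A B])
       (simp add: fun_eq_iff log_diff_def sum.distrib algebra_simps)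
qed

definition key_sum_diff ::
  "((nat ^ 'n) \<times> (nat ^ 'n) \<Rightarrow> complex) \<Rightarrow> ((nat ^ 'n) \<times> (nat ^ 'n)) set
     \<Rightarrow> complex ^ 'n::finite \<Rightarrow> complex ^ 'n \<Rightarrow> complex" where
  "key_sum_diff c K z \<eta> = (\<Sum>\<kappa>\<in>K. c \<kappa> * monomial \<kappa> z * log_diff \<kappa> \<eta>)"

lemma has_derivative_key_sum:
  assumes z: "z \<in> coord_torus UNIV"
  shows "(key_sum c K has_derivative (\<lambda>\<zeta>. key_sum_diff c K z (\<chi> j. \<zeta> $ j / z $ j))) (at z)"
  unfolding key_sum_def key_sum_diff_def
  by (rule has_derivative_eq_rhs, (rule has_derivative_sum has_derivative_mult_right has_derivative_monomial[OF z])+)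
     (simp add: mult_ac)

text \<open>A rank condition is awkward in limits.  A unit normal vector \<open>l\<close> to the image is a compact
  witness for it.\<close>

lemma low_rank_iff_orthogonal:
  fixes F :: "'a::euclidean_space \<Rightarrow> complex"
  shows "dim (F ` S) < 2 \<longleftrightarrow> (\<exists>l. norm l = 1 \<and> (\<forall>v\<in>S. l \<bullet> F v = 0))"
proof
  assume "dim (F ` S) < 2"
  then have "dim (F ` S) < DIM(complex)" by simp
  from lowdim_subset_hyperplane[OF this] obtain a where a: "a \<noteq> 0" "span (F ` S) \<subseteq> {x. a \<bullet> x = 0}"
    by blast
  have "sgn a \<bullet> F v = 0" if "v \<in> S" for v
  proof -
    have "F v \<in> span (F ` S)" using that by (auto intro: span_base)
    then show ?thesis using a(2) by (auto simp: sgn_div_norm)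
  qed
  then show "\<exists>l. norm l = 1 \<and> (\<forall>v\<in>S. l \<bullet> F v = 0)"
    using a(1) by (intro exI[of _ "sgn a"]) (auto simp: norm_sgn)
next
  assume "\<exists>l. norm l = 1 \<and> (\<forall>v\<in>S. l \<bullet> F v = 0)"
  then obtain l where l: "norm l = 1" "\<And>v. v \<in> S \<Longrightarrow> l \<bullet> F v = 0" by blast
  then have "F ` S \<subseteq> {x. l \<bullet> x = 0}" by auto
  then have "dim (F ` S) \<le> dim {x. l \<bullet> x = 0}" by (rule dim_subset)
  also have "\<dots> = 1" using l(1) by (subst dim_hyperplane) auto
  finally show "dim (F ` S) < 2" by simp
qed

lemma surj_if_not_orthogonal:
  fixes F :: "'a::euclidean_space \<Rightarrow> complex"
  assumes "linear F" "\<not> (\<exists>l. norm l = 1 \<and> (\<forall>v. l \<bullet> F v = 0))"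
  shows "surj F"
proof -
  have "\<not> dim (range F) < 2" using assms(2) low_rank_iff_orthogonal[of F UNIV] by simp
  moreover have "dim (range F) \<le> DIM(complex)" by (rule dim_subset_UNIV)
  ultimately have "dim (range F) = DIM(complex)" by simp
  then have "span (range F) = UNIV" by (simp only: dim_eq_full)
  then show ?thesis using assms(1)
    by (metis linear_subspace_image span_eq_iff subspace_UNIV)
qed

text \<open>At a point of the torus, passing to \<open>\<eta>\<^sub>j = \<zeta>\<^sub>j / z\<^sub>j\<close> is an automorphism of each coordinate
  subspace, so it does not change the image of the differential.\<close>

lemma critical_in_translate_iff:
  assumes "w + u \<in> coord_torus UNIV"
  shows "critical_in J (\<lambda>u. key_sum c K (w + u)) u \<longleftrightarrow>
    (\<exists>l. norm l = 1 \<and> (\<forall>\<eta>\<in>coord_subspace J. l \<bullet> key_sum_diff c K (w + u) \<eta> = 0))"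
proof -
  have "((\<lambda>u. key_sum c K (w + u)) has_derivative 
      (\<lambda>\<zeta>. key_sum_diff c K (w + u) (\<chi> j. \<zeta> $ j / (w + u) $ j))) (at u)"
  proof -
    have "((\<lambda>u. w + u) has_derivative (\<lambda>u. u)) (at u)"
      by (auto intro!: derivative_eq_intros)
    from has_derivative_compose[OF this has_derivative_key_sum[OF assms]] show ?thesis .
  qed
  then have F: "frechet_derivative (\<lambda>u. key_sum c K (w + u)) (at u) =
      (\<lambda>\<zeta>. key_sum_diff c K (w + u) (\<chi> j. \<zeta> $ j / (w + u) $ j))"
    by (rule frechet_derivative_at[symmetric])
  have nz: "(w + u) $ j \<noteq> 0" for j using assms by (auto simp: coord_torus_def)
  have im: "(\<lambda>\<zeta>. key_sum_diff c K (w + u) (\<chi> j. \<zeta> $ j / (w + u) $ j)) ` coord_subspace J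
      = key_sum_diff c K (w + u) ` coord_subspace J"
  proof (intro equalityI subsetI)
    fix y assume "y \<in> key_sum_diff c K (w + u) ` coord_subspace J"
    then obtain \<eta> where \<eta>: "\<eta> \<in> coord_subspace J" "y = key_sum_diff c K (w + u) \<eta>" by blast
    have "y = key_sum_diff c K (w + u) (\<chi> j. (\<chi> j. \<eta> $ j * (w + u) $ j) $ j / (w + u) $ j)"
      using nz \<eta>(2) by (simp del: vector_add_component)
    moreover have "(\<chi> j. \<eta> $ j * (w + u) $ j) \<in> coord_subspace J"
      using \<eta>(1) by (simp add: coord_subspace_def)
    ultimately show "y \<in> (\<lambda>\<zeta>. key_sum_diff c K (w + u) (\<chi> j. \<zeta> $ j / (w + u) $ j)) ` coord_subspace J"
      by blast
  qed (auto simp: coord_subspace_def)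
  show ?thesis unfolding critical_in_def F im by (rule low_rank_iff_orthogonal)
qed

lemma critical_point_iff:
  assumes "z \<in> coord_torus UNIV"
  shows "critical_point (key_sum c K) z \<longleftrightarrow> (\<exists>l. norm l = 1 \<and> (\<forall>\<eta>. l \<bullet> key_sum_diff c K z \<eta> = 0))"
  using critical_in_translate_iff[of 0 z UNIV c K] assms by (simp add: coord_subspace_def)

text \<open>Sussmann's open mapping theorem in the form used below.\<close>

lemma interior_image_of_regular_point:
  fixes F :: "'a::euclidean_space \<Rightarrow> 'b::euclidean_space"
  assumes "continuous_on UNIV F" "(F has_derivative F') (at x)" "surj F'" "open U" "x \<in> U"
  shows "F x \<in> interior (F ` U)"
proof -
  have "linear F'" using assms(2) by (rule has_derivative_linear)
  from linear_surjective_right_inverse[OF this assms(3)] 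
  obtain g where "linear g" "F' \<circ> g = id" by blast
  then show ?thesis
    using assms by (intro sussmann_open_mapping[of UNIV F x F' g U])
      (auto simp: interior_open linear_linear)
qed

section \<open>Faces of the Newton polyhedron cut out by weights\<close>

text \<open>The monomials of the face function for the weight \<open>P\<close>, described without the Newton polyhedron
  so that the notion also applies to a restriction of \<open>f\<close> to a coordinate subspace.\<close>

definition minimal_keys ::
  "real ^ 'n \<Rightarrow> ((nat ^ 'n) \<times> (nat ^ 'n)) set \<Rightarrow> ((nat ^ 'n) \<times> (nat ^ 'n::finite)) set" where
  "minimal_keys P K = {\<kappa> \<in> K. \<forall>\<kappa>'\<in>K. P \<bullet> exponent \<kappa> \<le> P \<bullet> exponent \<kappa>'}"

lemma minimal_keys_nonempty:
  assumes "finite K" "K \<noteq> {}"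
  shows "minimal_keys P K \<noteq> {}"
proof -
  from ex_is_arg_min_if_finite[OF assms, of "\<lambda>\<kappa>. P \<bullet> exponent \<kappa>"] obtain \<kappa>
    where "is_arg_min (\<lambda>\<kappa>. P \<bullet> exponent \<kappa>) (\<lambda>\<kappa>. \<kappa> \<in> K) \<kappa>" by blast
  then have "\<kappa> \<in> minimal_keys P K"
    by (auto simp: minimal_keys_def is_arg_min_linorder)
  then show ?thesis by blast
qed

lemma exponent_plus_orthant_in_newton_polyhedron:
  assumes "\<kappa> \<in> Poly_Mapping.keys f" "\<forall>j. 0 \<le> \<eta> $ j"
  shows "exponent \<kappa> + \<eta> \<in> newton_polyhedron f"
  unfolding newton_polyhedron_def
  using assms by (intro hull_inc) (auto intro!: bexI[of _ \<kappa>])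

text \<open>Separating the compact part from the orthant gives, for a positive weight, compactness of the face
  and, for a weight with zeros, its rays.\<close>

lemma newton_polyhedron_eq:
  "newton_polyhedron f = {\<xi> + \<eta> | \<xi> \<eta>. \<xi> \<in> convex hull (exponent ` Poly_Mapping.keys f) \<and> (\<forall>j. 0 \<le> \<eta> $ j)}"
proof -
  let ?O = "{\<eta>::real^'a. \<forall>j. 0 \<le> \<eta> $ j}"
  have O: "convex ?O" by (auto simp: convex_def)
  have "newton_polyhedron f = convex hull ((exponent ` Poly_Mapping.keys f) + ?O)"
    unfolding newton_polyhedron_def set_plus_def
    by (rule arg_cong[where f = "\<lambda>S. convex hull S"]) (auto simp: case_prod_beta, (metis prod.collapse)?)
  also have "\<dots> = convex hull (exponent ` Poly_Mapping.keys f) + ?O"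
    using O by (simp add: convex_hull_set_plus hull_same)
  finally show ?thesis by (auto simp: set_plus_def)
qed

context
  fixes f :: "'n::finite mixed_poly" and P :: "real ^ 'n" and \<kappa>
  assumes P: "\<forall>i. 0 \<le> P $ i" and \<kappa>: "\<kappa> \<in> minimal_keys P (Poly_Mapping.keys f)"
begin

lemma minimal_key_in_newton_polyhedron: "exponent \<kappa> \<in> newton_polyhedron f"
  using exponent_plus_orthant_in_newton_polyhedron[of \<kappa> f 0] \<kappa> by (simp add: minimal_keys_def)

lemma newton_polyhedron_weight_ge:
  assumes "\<xi> \<in> newton_polyhedron f"
  shows "P \<bullet> exponent \<kappa> \<le> P \<bullet> \<xi>"
proof -
  have "newton_polyhedron f \<subseteq> {\<xi>. P \<bullet> exponent \<kappa> \<le> P \<bullet> \<xi>}"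
    unfolding newton_polyhedron_def
  proof (rule hull_minimal)
    have "P \<bullet> exponent \<kappa> \<le> P \<bullet> exponent \<kappa>' + P \<bullet> \<eta>" if "\<kappa>' \<in> Poly_Mapping.keys f" "\<forall>j. 0 \<le> \<eta> $ j" for \<kappa>' \<eta>
    proof -
      have "0 \<le> P \<bullet> \<eta>" using P that by (auto simp: inner_vec_def intro!: sum_nonneg)
      moreover have "P \<bullet> exponent \<kappa> \<le> P \<bullet> exponent \<kappa>'"
        using \<kappa> that by (simp add: minimal_keys_def)
      ultimately show ?thesis by linarith
    qed
    then show "(\<Union>(\<nu>, \<mu>)\<in>Poly_Mapping.keys f. {total_exponent \<nu> \<mu> + \<eta> |\<eta>. \<forall>j. 0 \<le> \<eta> $ j})
        \<subseteq> {\<xi>. P \<bullet> exponent \<kappa> \<le> P \<bullet> \<xi>}"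
      by (fastforce simp: inner_add_right)
  qed (rule convex_halfspace_ge)
  then show ?thesis using assms by blast
qed

lemma weight_face_eq:
  "weight_face f P = newton_polyhedron f \<inter> {\<xi>. P \<bullet> \<xi> = P \<bullet> exponent \<kappa>}"
  using newton_polyhedron_weight_ge minimal_key_in_newton_polyhedron
  unfolding weight_face_def by (auto intro: antisym)

lemma weight_face_face_of: "weight_face f P face_of newton_polyhedron f"
  unfolding weight_face_eq
  by (rule face_of_Int_supporting_hyperplane_ge)
     (auto simp: newton_polyhedron_def convex_convex_hull dest: newton_polyhedron_weight_ge[unfolded newton_polyhedron_def])

lemma weight_face_nonempty: "weight_face f P \<noteq> {}"
  using weight_face_eq minimal_key_in_newton_polyhedron by blast

lemma mixed_part_weight_face:
  "mixed_part f (weight_face f P) = key_sum (Poly_Mapping.lookup f) (minimal_keys P (Poly_Mapping.keys f))"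
proof -
  have "exponent \<kappa>' \<in> weight_face f P \<longleftrightarrow> \<kappa>' \<in> minimal_keys P (Poly_Mapping.keys f)"
    if "\<kappa>' \<in> Poly_Mapping.keys f" for \<kappa>'
    using exponent_plus_orthant_in_newton_polyhedron[of \<kappa>' f 0] that \<kappa>
    by (fastforce simp: weight_face_eq minimal_keys_def)
  then have "{\<kappa> \<in> Poly_Mapping.keys f. exponent \<kappa> \<in> weight_face f P} = minimal_keys P (Poly_Mapping.keys f)"
    by (auto simp: minimal_keys_def)
  then show ?thesis by (simp add: mixed_part_eq_key_sum)
qed

text \<open>The weight does not see the direction \<open>axis i 1\<close>, and the polyhedron is stable under it.  Such
  rays make the face non-compact and essential.\<close>

lemma weight_face_add_ray:
  assumes "i \<in> weight_zeros P" "\<xi> \<in> weight_face f P" "0 \<le> t"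
  shows "\<xi> + t *\<^sub>R axis i 1 \<in> weight_face f P"
proof -
  have "P \<bullet> axis i (1::real) = 0" using assms(1) by (simp add: weight_zeros_def inner_axis)
  moreover have "\<xi> + t *\<^sub>R axis i 1 \<in> newton_polyhedron f"
  proof -
    from assms(2) obtain a b where ab: "\<xi> = a + b"
      "a \<in> convex hull (exponent ` Poly_Mapping.keys f)" "\<forall>j. 0 \<le> b $ j"
      by (auto simp: weight_face_eq newton_polyhedron_eq)
    have "\<xi> + t *\<^sub>R axis i 1 = a + (b + t *\<^sub>R axis i 1)" "\<forall>j. 0 \<le> (b + t *\<^sub>R axis i 1) $ j"
      using ab assms(3) by (auto simp: axis_def)
    then show ?thesis using ab(2) unfolding newton_polyhedron_eq by blast
  qed
  ultimately show ?thesis using assms(2) by (simp add: weight_face_eq inner_add_right)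
qed

lemma essential_face_weight_face:
  assumes "weight_zeros P \<noteq> {}" "vanishes_on f (weight_zeros P)"
  shows "essential_face f (weight_face f P) (weight_zeros P)"
proof -
  obtain i where i: "i \<in> weight_zeros P" using assms(1) by blast
  obtain \<xi> where \<xi>: "\<xi> \<in> weight_face f P" using weight_face_nonempty by blast
  have "\<not> compact (weight_face f P)"
  proof
    assume "compact (weight_face f P)"
    then obtain b where b: "\<And>x. x \<in> weight_face f P \<Longrightarrow> norm x \<le> b"
      by (meson bounded_iff compact_imp_bounded)
    define t where "t = norm \<xi> + \<bar>b\<bar> + 1"
    have "t = norm (t *\<^sub>R axis i (1::real))" by (simp add: t_def)
    also have "\<dots> \<le> norm (\<xi> + t *\<^sub>R axis i 1) + norm \<xi>"
      by (metis add.commute norm_triangle_sub add_diff_cancel_left' norm_minus_commute)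
    also have "\<dots> \<le> b + norm \<xi>"
      using b[OF weight_face_add_ray[OF i \<xi>, of t]] by (simp add: t_def)
    finally show False by (simp add: t_def)
  qed
  then show ?thesis
    using P assms(2) weight_face_add_ray unfolding essential_face_def by blast
qed

text \<open>A point of the face is a point of the convex hull of the exponents plus an orthant vector of weight
  \<open>0\<close>, and for a positive weight that vector vanishes.\<close>

lemma compact_weight_face:
  assumes "\<forall>i. 0 < P $ i"
  shows "compact (weight_face f P)"
proof -
  let ?C = "convex hull (exponent ` Poly_Mapping.keys f)"
  have sub: "?C \<subseteq> newton_polyhedron f"
    unfolding newton_polyhedron_eq by (force intro: exI[of _ 0])
  have "weight_face f P = ?C \<inter> {\<xi>. P \<bullet> \<xi> = P \<bullet> exponent \<kappa>}"
  proof (intro equalityI subsetI)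
    fix \<xi> assume \<xi>: "\<xi> \<in> weight_face f P"
    then obtain a b where ab: "\<xi> = a + b" "a \<in> ?C" "\<forall>j. 0 \<le> b $ j"
      by (auto simp: weight_face_eq newton_polyhedron_eq)
    have eq: "P \<bullet> a + P \<bullet> b = P \<bullet> exponent \<kappa>"
      using \<xi> ab(1) by (simp add: weight_face_eq inner_add_right)
    have "P \<bullet> exponent \<kappa> \<le> P \<bullet> a"
      using newton_polyhedron_weight_ge ab(2) sub by blast
    with eq have "P \<bullet> b \<le> 0" by linarith
    moreover have nn: "0 \<le> P $ j * b $ j" for j using P ab(3) by simp
    ultimately have "(\<Sum>j\<in>UNIV. P $ j * b $ j) = 0"
      by (intro antisym sum_nonneg) (auto simp: inner_vec_def)
    then have "P $ j * b $ j = 0" for j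
      using sum_nonneg_eq_0_iff[of UNIV "\<lambda>j. P $ j * b $ j"] nn by simp
    then have "b = 0" using assms by (simp add: vec_eq_iff) (metis less_irrefl)
    then show "\<xi> \<in> ?C \<inter> {\<xi>. P \<bullet> \<xi> = P \<bullet> exponent \<kappa>}"
      using ab \<xi> by (simp add: weight_face_eq)
  qed (use sub weight_face_eq in auto)
  moreover have "compact (?C \<inter> {\<xi>. P \<bullet> \<xi> = P \<bullet> exponent \<kappa>})"
    by (intro compact_Int_closed closed_hyperplane finite_imp_compact_convex_hull) simp
  ultimately show ?thesis by simp
qed

end

section \<open>Absence of critical points near the origin\<close>

lemma finite_family_convergent_subsequence:
  fixes X :: "'i \<Rightarrow> nat \<Rightarrow> 'a::heine_borel"
  assumes "finite A" "\<And>a. a \<in> A \<Longrightarrow> bounded (range (X a))"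
  shows "\<exists>r. strict_mono (r :: nat \<Rightarrow> nat) \<and> (\<forall>a\<in>A. convergent (X a \<circ> r))"
  using assms
proof (induction A rule: finite_induct)
  case empty
  then show ?case using strict_mono_id by blast
next
  case (insert a A)
  then obtain r where r: "strict_mono (r :: nat \<Rightarrow> nat)" "\<forall>a\<in>A. convergent (X a \<circ> r)"
    by (metis insertCI)
  have "bounded (range (X a \<circ> r))"
    using insert.prems[of a] by (rule bounded_subset) auto
  then obtain l r' where r': "strict_mono r'" "((X a \<circ> r) \<circ> r') \<longlonglongrightarrow> l"
    using bounded_imp_convergent_subsequence by blast
  have "convergent (X b \<circ> (r \<circ> r'))" if "b \<in> insert a A" for b
  proof (cases "b = a")
    case True
    then show ?thesis using r'(2) by (auto simp: convergent_def o_assoc)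
  next
    case False
    then show ?thesis using r(2) r'(1) that convergent_subseq_convergent[of "X b \<circ> r" r'] by (auto simp: o_assoc)
  qed
  then show ?case using strict_mono_o[OF r(1) r'(1)] by blast
qed

text \<open>Project \<open>x\<close> orthogonally to the span of \<open>V\<close>: each coordinate in an orthonormal basis of that span
  is a linear combination of convergent sequences.\<close>

lemma projection_of_sequence:
  fixes x :: "nat \<Rightarrow> 'a::euclidean_space"
  assumes "\<And>v. v \<in> V \<Longrightarrow> convergent (\<lambda>k. x k \<bullet> v)"
  obtains q q' where "q \<longlonglongrightarrow> q'" "\<forall>k. \<forall>v\<in>V. q k \<bullet> v = x k \<bullet> v"
proof -
  obtain B where B: "pairwise orthogonal B" "\<And>b. b \<in> B \<Longrightarrow> norm b = 1" "independent B" "span B = span V"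
    using orthonormal_basis_subspace[OF subspace_span[of V]] by metis
  have fin: "finite B" using B(3) by (rule independent_imp_finite)
  have conv: "convergent (\<lambda>k. x k \<bullet> v)" if "v \<in> span V" for v
    using that
  proof (induction rule: span_induct)
    case base
    show ?case
      by (auto simp: subspace_def inner_add_right convergent_const intro: convergent_add 
          convergent_mult[OF convergent_const])
  next
    case (step v) then show ?case using assms by simp
  qed
  define q where "q = (\<lambda>k. \<Sum>b\<in>B. (x k \<bullet> b) *\<^sub>R b)"
  have "(\<lambda>k. x k \<bullet> b) \<longlonglongrightarrow> lim (\<lambda>k. x k \<bullet> b)" if "b \<in> B" for b
    using conv[of b] that B(4) span_base[of b B] by (simp add: convergent_LIMSEQ_iff)
  then have "q \<longlonglongrightarrow> (\<Sum>b\<in>B. lim (\<lambda>k. x k \<bullet> b) *\<^sub>R b)"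
    unfolding q_def by (intro tendsto_intros)
  moreover have "q k \<bullet> v = x k \<bullet> v" if "v \<in> V" for k v
  proof -
    have "v \<in> span B" using that B(4) span_base by blast
    from orthonormal_basis_expand[OF B(1,2) this fin]
    have v: "v = (\<Sum>b\<in>B. (v \<bullet> b) *\<^sub>R b)" by simp
    have "x k \<bullet> v = (\<Sum>b\<in>B. (v \<bullet> b) * (x k \<bullet> b))"
      by (subst v) (simp add: inner_sum_right)
    also have "\<dots> = q k \<bullet> v"
      by (simp add: q_def inner_sum_left mult.commute inner_commute[of v])
    finally show ?thesis by simp
  qed
  ultimately show ?thesis using that by blast
qed

text \<open>Let \<open>x k\<close> be the vector of the numbers \<open>- ln\<close> of the moduli of the coordinates of a sequence of
  points tending to \<open>0\<close>, so that \<open>W \<kappa> k\<close> is the normalised modulus of a monomial.  Let \<open>D\<close> be the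
  set of monomials that survive in the limit.  Pairings of \<open>x k\<close> with differences of exponents from
  \<open>D\<close> converge, so \<open>x k\<close> differs by a convergent sequence from a vector orthogonal to these
  differences.  That vector still tends to infinity in each coordinate and against
  the difference of an exponent outside \<open>D\<close> and one from \<open>D\<close>.  For large \<open>k\<close> it is the required weight, and the limit
  \<open>q\<close> of the convergent part gives the moduli \<open>exp (- q\<^sub>j)\<close> of the limiting torus point.\<close>

lemma limiting_weight:
  fixes x :: "nat \<Rightarrow> real ^ 'n::finite" and K :: "((nat ^ 'n) \<times> (nat ^ 'n)) set"
  defines "W \<equiv> \<lambda>\<kappa> k. exp (- (x k \<bullet> exponent \<kappa>)) / (\<Sum>\<kappa>'\<in>K. exp (- (x k \<bullet> exponent \<kappa>')))"
  assumes "finite K" "K \<noteq> {}"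
    and x: "\<And>j. filterlim (\<lambda>k. x k $ j) at_top sequentially"
    and s: "\<And>\<kappa>. \<kappa> \<in> K \<Longrightarrow> W \<kappa> \<longlonglongrightarrow> s \<kappa>"
  obtains P q C where "\<forall>j. 0 < P $ j" "0 < C"
    "\<And>\<kappa>. \<kappa> \<in> K \<Longrightarrow> s \<kappa> = (if \<kappa> \<in> minimal_keys P K then C * exp (- (q \<bullet> exponent \<kappa>)) else 0)"
proof -
  define S where "S = (\<lambda>k. \<Sum>\<kappa>'\<in>K. exp (- (x k \<bullet> exponent \<kappa>')))"
  have Spos: "0 < S k" for k unfolding S_def using assms(2,3) by (intro sum_pos) auto
  have W: "W \<kappa> k = exp (- (x k \<bullet> exponent \<kappa>)) / S k" for \<kappa> k by (simp add: W_def S_def)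
  have Wpos: "0 < W \<kappa> k" for \<kappa> k using Spos[of k] by (simp add: W)
  have lnW: "ln (W \<kappa> k) = - (x k \<bullet> exponent \<kappa>) - ln (S k)" for \<kappa> k
    using Spos[of k] by (simp add: W ln_div)
  have s0: "0 \<le> s \<kappa>" if "\<kappa> \<in> K" for \<kappa>
    by (rule LIMSEQ_le_const[OF s[OF that]]) (use Wpos less_imp_le in blast)
  have "(\<Sum>\<kappa>\<in>K. W \<kappa> k) = 1" for k
    using Spos[of k] by (simp add: W sum_divide_distrib[symmetric]) (simp add: S_def)
  moreover have "(\<lambda>k. \<Sum>\<kappa>\<in>K. W \<kappa> k) \<longlonglongrightarrow> (\<Sum>\<kappa>\<in>K. s \<kappa>)" by (intro tendsto_sum s)
  ultimately have sum1: "(\<Sum>\<kappa>\<in>K. s \<kappa>) = 1" by (simp add: LIMSEQ_const_iff)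
  define D where "D = {\<kappa>\<in>K. 0 < s \<kappa>}"
  have sD: "s \<kappa> = 0" if "\<kappa> \<in> K - D" for \<kappa> using that s0[of \<kappa>] by (auto simp: D_def)
  obtain \<kappa>\<^sub>0 where \<kappa>\<^sub>0: "\<kappa>\<^sub>0 \<in> D"
  proof -
    have "\<exists>\<kappa>\<in>K. s \<kappa> \<noteq> 0" using sum1 by (metis sum.neutral zero_neq_one)
    then show ?thesis using that sD by blast
  qed
  have lim: "(\<lambda>k. x k \<bullet> (exponent \<kappa> - exponent \<kappa>')) \<longlonglongrightarrow> ln (s \<kappa>') - ln (s \<kappa>)"
    if "\<kappa> \<in> D" "\<kappa>' \<in> D" for \<kappa> \<kappa>'
  proof -
    have "(\<lambda>k. ln (W \<kappa>' k) - ln (W \<kappa> k)) \<longlonglongrightarrow> ln (s \<kappa>') - ln (s \<kappa>)"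
      using that by (intro tendsto_intros s) (auto simp: D_def)
    then show ?thesis by (simp add: lnW inner_diff_right)
  qed
  define V where "V = (\<lambda>(\<kappa>, \<kappa>'). exponent \<kappa> - exponent \<kappa>') ` (D \<times> D)"
  have V: "exponent \<kappa> - exponent \<kappa>' \<in> V" if "\<kappa> \<in> D" "\<kappa>' \<in> D" for \<kappa> \<kappa>'
    using that unfolding V_def by (intro image_eqI[of _ _ "(\<kappa>, \<kappa>')"]) auto
  have conv: "convergent (\<lambda>k. x k \<bullet> v)" if "v \<in> V" for v
  proof -
    obtain \<kappa> \<kappa>' where "\<kappa> \<in> D" "\<kappa>' \<in> D" "v = exponent \<kappa> - exponent \<kappa>'"
      using \<open>v \<in> V\<close> unfolding V_def by fast
    then show ?thesis using lim convergentI by metis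
  qed
  obtain p q where p: "p \<longlonglongrightarrow> q" "\<forall>k. \<forall>v\<in>V. p k \<bullet> v = x k \<bullet> v"
    using projection_of_sequence[OF conv] by metis
  have peq: "p k \<bullet> (exponent \<kappa> - exponent \<kappa>') = x k \<bullet> (exponent \<kappa> - exponent \<kappa>')"
    if "\<kappa> \<in> D" "\<kappa>' \<in> D" for k \<kappa> \<kappa>'
    using p(2) V[OF that] by blast
  have div: "filterlim (\<lambda>k. (x k - p k) \<bullet> (exponent \<kappa>' - exponent \<kappa>)) at_top sequentially"
    if "\<kappa> \<in> D" "\<kappa>' \<in> K - D" for \<kappa> \<kappa>'
  proof -
    have "filterlim (W \<kappa>') (at_right 0) sequentially"
      using s[of \<kappa>'] sD[of \<kappa>'] Wpos[of \<kappa>'] that by (intro tendsto_imp_filterlim_at_right) simp_all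
    then have "filterlim (\<lambda>k. ln (W \<kappa>' k)) at_bot sequentially"
      by (rule filterlim_compose[OF ln_at_0])
    then have A: "filterlim (\<lambda>k. - ln (W \<kappa>' k)) at_top sequentially"
      by (simp add: filterlim_uminus_at_top)
    have B: "(\<lambda>k. ln (W \<kappa> k) - p k \<bullet> (exponent \<kappa>' - exponent \<kappa>)) \<longlonglongrightarrow> ln (s \<kappa>) - q \<bullet> (exponent \<kappa>' - exponent \<kappa>)"
      using that by (intro tendsto_intros s p(1)) (auto simp: D_def)
    have "filterlim (\<lambda>k. (ln (W \<kappa> k) - p k \<bullet> (exponent \<kappa>' - exponent \<kappa>)) + - ln (W \<kappa>' k)) at_top sequentially"
      by (rule filterlim_tendsto_add_at_top[OF B A])
    moreover have "(ln (W \<kappa> k) - p k \<bullet> (exponent \<kappa>' - exponent \<kappa>)) + - ln (W \<kappa>' k) =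
        (x k - p k) \<bullet> (exponent \<kappa>' - exponent \<kappa>)" for k
      by (simp add: lnW inner_diff_left inner_diff_right)
    ultimately show ?thesis by simp
  qed
  have pos: "filterlim (\<lambda>k. (x k - p k) $ j) at_top sequentially" for j
    using filterlim_tendsto_add_at_top[OF tendsto_minus[OF tendsto_vec_nth[OF p(1)]] x, of j j]
    by simp
  have "eventually (\<lambda>k. (\<forall>j. 0 < (x k - p k) $ j) \<and>
      (\<forall>\<kappa>\<in>D. \<forall>\<kappa>'\<in>K - D. 0 < (x k - p k) \<bullet> (exponent \<kappa>' - exponent \<kappa>))) sequentially"
    using pos div assms(2) 
    by (intro eventually_conj eventually_all_finite eventually_ball_finite ballI)
      (auto simp: D_def filterlim_at_top_dense simp del: vector_minus_component)
  from eventually_happens'[OF sequentially_bot this]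
  obtain k where k: "\<forall>j. 0 < (x k - p k) $ j"
    "\<forall>\<kappa>\<in>D. \<forall>\<kappa>'\<in>K - D. 0 < (x k - p k) \<bullet> (exponent \<kappa>' - exponent \<kappa>)"
    by blast
  have eqD: "(x k - p k) \<bullet> exponent \<kappa> = (x k - p k) \<bullet> exponent \<kappa>'" if "\<kappa> \<in> D" "\<kappa>' \<in> D" for \<kappa> \<kappa>'
    using peq[OF that, of k] by (simp add: inner_diff_left inner_diff_right)
  have ltD: "(x k - p k) \<bullet> exponent \<kappa> < (x k - p k) \<bullet> exponent \<kappa>'" if "\<kappa> \<in> D" "\<kappa>' \<in> K - D" for \<kappa> \<kappa>'
    using k(2)[rule_format, OF that] by (simp add: inner_diff_right)
  have D: "minimal_keys (x k - p k) K = D"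
  proof (intro equalityI subsetI)
    fix \<kappa> assume "\<kappa> \<in> minimal_keys (x k - p k) K"
    then show "\<kappa> \<in> D" using ltD[OF \<kappa>\<^sub>0, of \<kappa>] \<kappa>\<^sub>0 by (force simp: minimal_keys_def D_def)
  next
    fix \<kappa> assume \<kappa>: "\<kappa> \<in> D"
    have "(x k - p k) \<bullet> exponent \<kappa> \<le> (x k - p k) \<bullet> exponent \<kappa>'" if "\<kappa>' \<in> K" for \<kappa>'
      using eqD[OF \<kappa>, of \<kappa>'] ltD[OF \<kappa>, of \<kappa>'] that by (cases "\<kappa>' \<in> D") auto
    then show "\<kappa> \<in> minimal_keys (x k - p k) K" using \<kappa> by (auto simp: minimal_keys_def D_def)
  qed
  \<comment> \<open>Normalised at \<open>\<kappa>\<^sub>0\<close>: the limits of the monomials are exponential in the exponent only up to a common factor.\<close>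
  define C where "C = s \<kappa>\<^sub>0 * exp (q \<bullet> exponent \<kappa>\<^sub>0)"
  have "s \<kappa> = C * exp (- (q \<bullet> exponent \<kappa>))" if "\<kappa> \<in> D" for \<kappa>
  proof -
    have "(\<lambda>k. x k \<bullet> (exponent \<kappa> - exponent \<kappa>\<^sub>0)) \<longlonglongrightarrow> q \<bullet> (exponent \<kappa> - exponent \<kappa>\<^sub>0)"
      using peq[OF that \<kappa>\<^sub>0] tendsto_inner[OF p(1) tendsto_const[of "exponent \<kappa> - exponent \<kappa>\<^sub>0"]] by simp
    with lim[OF that \<kappa>\<^sub>0] have "ln (s \<kappa>\<^sub>0) - ln (s \<kappa>) = q \<bullet> (exponent \<kappa> - exponent \<kappa>\<^sub>0)"
      by (rule LIMSEQ_unique)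
    then have "ln (s \<kappa>) = ln (s \<kappa>\<^sub>0) + (q \<bullet> exponent \<kappa>\<^sub>0 - q \<bullet> exponent \<kappa>)"
      by (simp add: inner_diff_right)
    then have "exp (ln (s \<kappa>)) = exp (ln (s \<kappa>\<^sub>0)) * (exp (q \<bullet> exponent \<kappa>\<^sub>0) * exp (- (q \<bullet> exponent \<kappa>)))"
      by (simp add: exp_add exp_diff exp_minus divide_inverse)
    then show ?thesis using that \<kappa>\<^sub>0 by (simp add: C_def D_def)
  qed
  moreover have "0 < C" using \<kappa>\<^sub>0 by (simp add: C_def D_def)
  ultimately show ?thesis
    using that[of "x k - p k" C q] k(1) sD by (auto simp: D)
qed

text \<open>A sequence of critical points tending to \<open>0\<close> would produce, after normalising by the sum of the
  moduli of the monomials, a critical point of a face function: the normal vectors, the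
  phases and the normalised moduli stay in compact sets, \<open>limiting_weight\<close> identifies the limits of
  the moduli, and the logarithmic differentials do not depend on the point.\<close>

lemma no_critical_point_near_zero:
  fixes K :: "((nat ^ 'n::finite) \<times> (nat ^ 'n)) set"
  assumes fin: "finite K" "K \<noteq> {}"
    and nc: "\<And>P z. \<forall>j. 0 < P $ j \<Longrightarrow> z \<in> coord_torus UNIV \<Longrightarrow> \<not> critical_point (key_sum c (minimal_keys P K)) z"
  obtains r where "0 < r" "\<And>b. b \<in> coord_torus UNIV \<Longrightarrow> (\<And>j. cmod (b $ j) < r) \<Longrightarrow> \<not> critical_point (key_sum c K) b"
proof (rule ccontr)
  assume "\<not> thesis"
  then have "\<exists>b. b \<in> coord_torus UNIV \<and> (\<forall>j. cmod (b $ j) < inverse (real (Suc k))) \<and> critical_point (key_sum c K) b" for k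
    using that[of "inverse (real (Suc k))"] by auto
  then obtain b where b: "\<And>k. b k \<in> coord_torus UNIV" "\<And>k j. cmod (b k $ j) < inverse (real (Suc k))"
    "\<And>k. critical_point (key_sum c K) (b k)" by metis
  then have "\<exists>l. norm l = 1 \<and> (\<forall>\<eta>. l \<bullet> key_sum_diff c K (b k) \<eta> = 0)" for k
    by (simp add: critical_point_iff)
  then obtain l where l: "\<And>k. norm (l k) = 1" "\<And>k \<eta>. l k \<bullet> key_sum_diff c K (b k) \<eta> = 0" by metis
  have nz: "b k $ j \<noteq> 0" for k j using b(1)[of k] by (auto simp: coord_torus_def)
  define x where "x = (\<lambda>k. \<chi> j. - ln (cmod (b k $ j)))"
  define ph where "ph = (\<lambda>k. \<chi> j. sgn (b k $ j))"
  have ph1: "cmod (ph k $ j) = 1" for k j using nz[of k j] by (simp add: ph_def norm_sgn)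
  have bk: "b k = rescale (- x k) (ph k)" for k
  proof -
    have "b k $ j = of_real (exp (- x k $ j)) * ph k $ j" for j
      using nz[of k j] by (simp add: x_def ph_def sgn_div_norm scaleR_conv_of_real)
    then show ?thesis by (simp add: vec_eq_iff rescale_def)
  qed
  define W where "W = (\<lambda>\<kappa> k. exp (- (x k \<bullet> exponent \<kappa>)) / (\<Sum>\<kappa>'\<in>K. exp (- (x k \<bullet> exponent \<kappa>'))))"
  have Spos: "0 < (\<Sum>\<kappa>'\<in>K. exp (- (x k \<bullet> exponent \<kappa>')))" for k using fin by (intro sum_pos) auto
  have xlim: "filterlim (\<lambda>k. x k $ j) at_top sequentially" for j
  proof -
    have "(\<lambda>k. cmod (b k $ j)) \<longlonglongrightarrow> 0"
      using b(2) by (intro tendsto_sandwich[OF _ _ tendsto_const LIMSEQ_inverse_real_of_nat])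
        (auto intro!: always_eventually less_imp_le)
    then have "filterlim (\<lambda>k. cmod (b k $ j)) (at_right 0) sequentially"
      using nz by (auto simp: filterlim_at intro!: always_eventually)
    then have "filterlim (\<lambda>k. ln (cmod (b k $ j))) at_bot sequentially"
      by (rule filterlim_compose[OF ln_at_0])
    then show ?thesis by (simp add: x_def filterlim_uminus_at_top)
  qed
  have bdd: "bounded (range (W \<kappa>))" if "\<kappa> \<in> K" for \<kappa>
  proof -
    have "norm (W \<kappa> k) \<le> 1" for k
    proof -
      have "exp (- (x k \<bullet> exponent \<kappa>)) \<le> (\<Sum>\<kappa>'\<in>K. exp (- (x k \<bullet> exponent \<kappa>')))"
        using that fin(1) by (intro member_le_sum) auto
      then show ?thesis using Spos[of k] by (simp add: W_def)
    qed
    then show ?thesis by (auto simp: bounded_iff)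
  qed
  have "bounded (range (\<lambda>k. (l k, ph k)))"
  proof -
    have "norm (ph k) \<le> (\<Sum>j\<in>UNIV. cmod (ph k $ j))" for k unfolding norm_vec_def by (rule L2_set_le_sum) simp
    then have "norm (ph k) \<le> CARD('n)" for k by (simp add: ph1)
    then have "bounded (range ph)" by (auto simp: bounded_iff)
    moreover have "bounded (range l)" using l(1) by (auto simp: bounded_iff)
    ultimately have "bounded (range l \<times> range ph)" by (rule bounded_Times[rotated])
    then show ?thesis by (rule bounded_subset) auto
  qed
  then obtain m r1 where r1: "strict_mono (r1 :: nat \<Rightarrow> nat)" "((\<lambda>k. (l k, ph k)) \<circ> r1) \<longlonglongrightarrow> m"
    using bounded_imp_convergent_subsequence by blast
  have "bounded (range (W \<kappa> \<circ> r1))" if "\<kappa> \<in> K" for \<kappa>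
    using bdd[OF that] by (rule bounded_subset) auto
  with finite_family_convergent_subsequence[OF fin(1), of "\<lambda>\<kappa>. W \<kappa> \<circ> r1"]
  obtain r2 where r2: "strict_mono (r2 :: nat \<Rightarrow> nat)" "\<forall>\<kappa>\<in>K. convergent (W \<kappa> \<circ> r1 \<circ> r2)" by blast
  define r where "r = r1 \<circ> r2"
  have r: "strict_mono r" using r1(1) r2(1) by (simp add: r_def strict_mono_o)
  define s where "s = (\<lambda>\<kappa>. lim (W \<kappa> \<circ> r))"
  have s: "(\<lambda>k. W \<kappa> (r k)) \<longlonglongrightarrow> s \<kappa>" if "\<kappa> \<in> K" for \<kappa>
    using r2(2) that by (simp add: s_def r_def convergent_LIMSEQ_iff o_def)
  obtain l' ph' where m: "m = (l', ph')" by (cases m)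
  have lph: "(\<lambda>k. (l (r k), ph (r k))) \<longlonglongrightarrow> (l', ph')"
    using LIMSEQ_subseq_LIMSEQ[OF r1(2) r2(1)] by (simp add: r_def o_def m)
  have llim: "(\<lambda>k. l (r k)) \<longlonglongrightarrow> l'" and phlim: "(\<lambda>k. ph (r k)) \<longlonglongrightarrow> ph'"
    using tendsto_fst[OF lph] tendsto_snd[OF lph] by simp_all
  have l1: "norm l' = 1"
    using tendsto_norm[OF llim] l(1) by (simp add: LIMSEQ_const_iff)
  have phi1: "cmod (ph' $ j) = 1" for j
    using tendsto_norm[OF tendsto_vec_nth[OF phlim, of j]] ph1 by (simp add: LIMSEQ_const_iff)
  have xr: "filterlim (\<lambda>k. x (r k) $ j) at_top sequentially" for j
    using xlim[of j] filterlim_subseq[OF r] by (rule filterlim_compose)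
  obtain P q C where P: "\<forall>j. 0 < P $ j" "0 < C"
    "\<And>\<kappa>. \<kappa> \<in> K \<Longrightarrow> s \<kappa> = (if \<kappa> \<in> minimal_keys P K then C * exp (- (q \<bullet> exponent \<kappa>)) else 0)"
    using limiting_weight[of K "\<lambda>k. x (r k)" s, OF fin xr s[unfolded W_def]] by metis
  define u where "u = rescale (- q) ph'"
  have u: "u \<in> coord_torus UNIV"
  proof -
    have "ph' $ j \<noteq> 0" for j using phi1[of j] by auto
    then show ?thesis by (simp add: u_def rescale_def coord_torus_def coord_subspace_def)
  qed
  have "l' \<bullet> key_sum_diff c (minimal_keys P K) u \<eta> = 0" for \<eta>
  proof -
    have "l k \<bullet> (\<Sum>\<kappa>\<in>K. c \<kappa> * (of_real (W \<kappa> k) * monomial \<kappa> (ph k)) * log_diff \<kappa> \<eta>) = 0" for k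
    proof -
      define S where "S = (\<Sum>\<kappa>'\<in>K. exp (- (x k \<bullet> exponent \<kappa>')))"
      have S: "0 < S" using Spos by (simp add: S_def)
      have "of_real (W \<kappa> k) * monomial \<kappa> (ph k) = monomial \<kappa> (b k) / of_real S" for \<kappa>
        using S by (simp add: bk monomial_rescale W_def S_def[symmetric])
      then have "(\<Sum>\<kappa>\<in>K. c \<kappa> * (of_real (W \<kappa> k) * monomial \<kappa> (ph k)) * log_diff \<kappa> \<eta>) = 
          inverse S *\<^sub>R key_sum_diff c K (b k) \<eta>"
        by (simp add: key_sum_diff_def scaleR_conv_of_real divide_inverse sum_distrib_left mult_ac)
      then show ?thesis using l(2) by simp
    qed
    moreover have "(\<lambda>k. l (r k) \<bullet> (\<Sum>\<kappa>\<in>K. c \<kappa> * (of_real (W \<kappa> (r k)) * monomial \<kappa> (ph (r k))) * log_diff \<kappa> \<eta>)) \<longlonglongrightarrow>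
        l' \<bullet> (\<Sum>\<kappa>\<in>K. c \<kappa> * (of_real (s \<kappa>) * monomial \<kappa> ph') * log_diff \<kappa> \<eta>)"
    proof (intro tendsto_intros llim s)
      show "(\<lambda>k. monomial \<kappa> (ph (r k))) \<longlonglongrightarrow> monomial \<kappa> ph'" for \<kappa>
        by (rule continuous_on_tendsto_compose[OF continuous_on_monomial[of UNIV] phlim]) auto
    qed
    ultimately have "l' \<bullet> (\<Sum>\<kappa>\<in>K. c \<kappa> * (of_real (s \<kappa>) * monomial \<kappa> ph') * log_diff \<kappa> \<eta>) = 0"
      by (simp add: LIMSEQ_const_iff)
    also have "(\<Sum>\<kappa>\<in>K. c \<kappa> * (of_real (s \<kappa>) * monomial \<kappa> ph') * log_diff \<kappa> \<eta>) =
        (\<Sum>\<kappa>\<in>minimal_keys P K. c \<kappa> * (of_real (s \<kappa>) * monomial \<kappa> ph') * log_diff \<kappa> \<eta>)"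
      using fin(1) P(3) by (intro sum.mono_neutral_right) (auto simp: minimal_keys_def)
    also have "\<dots> = C *\<^sub>R key_sum_diff c (minimal_keys P K) u \<eta>"
      unfolding key_sum_diff_def scaleR_sum_right
    proof (rule sum.cong)
      fix \<kappa> assume "\<kappa> \<in> minimal_keys P K"
      then have "s \<kappa> = C * exp (- (q \<bullet> exponent \<kappa>))" using P(3)[of \<kappa>] by (simp add: minimal_keys_def)
      then show "c \<kappa> * (of_real (s \<kappa>) * monomial \<kappa> ph') * log_diff \<kappa> \<eta> = C *\<^sub>R (c \<kappa> * monomial \<kappa> u * log_diff \<kappa> \<eta>)"
        by (simp add: u_def monomial_rescale scaleR_conv_of_real mult_ac)
    qed simp
    finally show ?thesis using P(2) by simp
  qed
  then have "critical_point (key_sum c (minimal_keys P K)) u"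
    using l1 by (auto simp: critical_point_iff[OF u])
  then show False using nc[OF P(1) u] by blast
qed

section \<open>Directions attained by a face function\<close>

text \<open>Positional notation: choosing each new weight larger than any value of the sum over the earlier
  coordinates makes the digits \<open>a j \<le> M\<close> recoverable from the weighted sum.\<close>

lemma separating_weight:
  fixes J :: "'i set"
  assumes "finite J"
  obtains p :: "'i \<Rightarrow> nat" where "\<And>j. j \<in> J \<Longrightarrow> 0 < p j"
    "\<And>a b. (\<And>j. j \<in> J \<Longrightarrow> a j \<le> M) \<Longrightarrow> (\<And>j. j \<in> J \<Longrightarrow> b j \<le> M) \<Longrightarrow>
        (\<Sum>j\<in>J. p j * a j) = (\<Sum>j\<in>J. p j * b j) \<Longrightarrow> \<forall>j\<in>J. a j = b j"
proof -
  have "\<exists>p :: 'i \<Rightarrow> nat. (\<forall>j\<in>J. 0 < p j) \<and> (\<forall>a b. (\<forall>j\<in>J. a j \<le> M) \<longrightarrow> (\<forall>j\<in>J. b j \<le> M) \<longrightarrow>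
        (\<Sum>j\<in>J. p j * a j) = (\<Sum>j\<in>J. p j * b j) \<longrightarrow> (\<forall>j\<in>J. a j = b j))"
    using assms
  proof (induction J rule: finite_induct)
    case (insert i J)
    from insert.IH obtain p :: "'i \<Rightarrow> nat" where p: "\<forall>j\<in>J. 0 < p j"
      "\<forall>a b. (\<forall>j\<in>J. a j \<le> M) \<longrightarrow> (\<forall>j\<in>J. b j \<le> M) \<longrightarrow>
        (\<Sum>j\<in>J. p j * a j) = (\<Sum>j\<in>J. p j * b j) \<longrightarrow> (\<forall>j\<in>J. a j = b j)" by (elim exE conjE)
    define N where "N = Suc (\<Sum>j\<in>J. p j * M)"
    define p' where "p' = p(i := N)"
    have sum': "(\<Sum>j\<in>insert i J. p' j * a j) = N * a i + (\<Sum>j\<in>J. p j * a j)" for a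
    proof -
      have "(\<Sum>j\<in>J. p' j * a j) = (\<Sum>j\<in>J. p j * a j)"
        using insert.hyps(2) by (intro sum.cong) (auto simp: p'_def)
      then show ?thesis using insert.hyps by (simp add: p'_def)
    qed
    have small: "(\<Sum>j\<in>J. p j * a j) < N" if "\<forall>j\<in>J. a j \<le> M" for a
      using that by (auto simp: N_def less_Suc_eq_le intro!: sum_mono)
    have sep: "\<forall>j\<in>insert i J. a j = b j" if a: "\<forall>j\<in>insert i J. a j \<le> M" and b: "\<forall>j\<in>insert i J. b j \<le> M"
      and eq: "(\<Sum>j\<in>insert i J. p' j * a j) = (\<Sum>j\<in>insert i J. p' j * b j)" for a b
    proof -
      let ?A = "\<Sum>j\<in>J. p j * a j" and ?B = "\<Sum>j\<in>J. p j * b j"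
      have eq': "N * a i + ?A = N * b i + ?B" using eq by (simp only: sum')
      have sA: "?A < N" and sB: "?B < N" using a b by (auto intro: small)
      have "(N * a i + ?A) div N = a i" "(N * b i + ?B) div N = b i"
        using sA sB by auto
      then have ab: "a i = b i" using eq' by metis
      with eq' have AB: "?A = ?B" by simp
      have aM: "\<forall>j\<in>J. a j \<le> M" and bM: "\<forall>j\<in>J. b j \<le> M" using a b by simp_all
      have "\<forall>j\<in>J. a j = b j" by (rule mp[OF mp[OF mp[OF spec[OF spec[OF p(2)]] aM] bM] AB])
      with ab show ?thesis by simp
    qed
    have pos: "\<forall>j\<in>insert i J. 0 < p' j" using p(1) by (auto simp: p'_def N_def)
    show ?case by (intro exI[of _ p'] conjI allI impI, rule pos, erule (2) sep)
  qed auto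
  then obtain p :: "'i \<Rightarrow> nat" where "\<forall>j\<in>J. 0 < p j"
      "\<forall>a b. (\<forall>j\<in>J. a j \<le> M) \<longrightarrow> (\<forall>j\<in>J. b j \<le> M) \<longrightarrow>
        (\<Sum>j\<in>J. p j * a j) = (\<Sum>j\<in>J. p j * b j) \<longrightarrow> (\<forall>j\<in>J. a j = b j)" by (elim exE conjE)
  then show ?thesis by (intro that[of p]) simp_all
qed

text \<open>A separating weight outside \<open>I\<close> forces all minimal monomials to have the same total exponent there.
  This is what makes the face function homogeneous in each modulus separately.\<close>

lemma adapted_weight:
  fixes K :: "((nat ^ 'n::finite) \<times> (nat ^ 'n)) set"
  assumes "finite K"
  shows "\<exists>p :: 'n \<Rightarrow> nat. (\<forall>j. p j = 0 \<longleftrightarrow> j \<in> I) \<and>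
    (\<forall>\<kappa>\<in>minimal_keys (\<chi> j. real (p j)) K. \<forall>\<kappa>'\<in>minimal_keys (\<chi> j. real (p j)) K. \<forall>j.
       j \<notin> I \<longrightarrow> exponent \<kappa> $ j = exponent \<kappa>' $ j)"
proof -
  let ?m = "\<lambda>\<kappa> :: (nat ^ 'n) \<times> (nat ^ 'n). \<lambda>j. fst \<kappa> $ j + snd \<kappa> $ j"
  define M where "M = (\<Sum>\<kappa>\<in>K. \<Sum>j\<in>UNIV. ?m \<kappa> j)"
  have M: "?m \<kappa> j \<le> M" if "\<kappa> \<in> K" for \<kappa> j
  proof -
    have "?m \<kappa> j \<le> (\<Sum>j\<in>UNIV. ?m \<kappa> j)" by (rule member_le_sum) auto
    also have "\<dots> \<le> M" unfolding M_def using assms that by (intro member_le_sum) auto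
    finally show ?thesis .
  qed
  obtain p' :: "'n \<Rightarrow> nat" where p': "\<And>j. j \<in> - I \<Longrightarrow> 0 < p' j"
    "\<And>a b. (\<And>j. j \<in> - I \<Longrightarrow> a j \<le> M) \<Longrightarrow> (\<And>j. j \<in> - I \<Longrightarrow> b j \<le> M) \<Longrightarrow>
        (\<Sum>j\<in>- I. p' j * a j) = (\<Sum>j\<in>- I. p' j * b j) \<Longrightarrow> \<forall>j\<in>- I. a j = b j"
    using separating_weight[of "- I" M] by auto
  define p where "p = (\<lambda>j. if j \<in> I then 0 else p' j)"
  have Pe: "(\<chi> j. real (p j)) \<bullet> exponent \<kappa> = real (\<Sum>j\<in>- I. p' j * ?m \<kappa> j)" for \<kappa>
  proof -
    have "(\<chi> j. real (p j)) \<bullet> exponent \<kappa> = real (\<Sum>j\<in>UNIV. p j * ?m \<kappa> j)"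
      by (simp add: inner_vec_def total_exponent_def)
    also have "(\<Sum>j\<in>UNIV. p j * ?m \<kappa> j) = (\<Sum>j\<in>- I. p' j * ?m \<kappa> j)"
      by (intro sum.mono_neutral_cong_right) (auto simp: p_def)
    finally show ?thesis .
  qed
  show ?thesis
  proof (intro exI[of _ p] conjI)
    show "\<forall>j. p j = 0 \<longleftrightarrow> j \<in> I" using p'(1) by (auto simp: p_def)
    show "\<forall>\<kappa>\<in>minimal_keys (\<chi> j. real (p j)) K. \<forall>\<kappa>'\<in>minimal_keys (\<chi> j. real (p j)) K. \<forall>j.
       j \<notin> I \<longrightarrow> exponent \<kappa> $ j = exponent \<kappa>' $ j"
    proof (intro ballI allI impI)
      fix \<kappa> \<kappa>' j
      assume \<kappa>: "\<kappa> \<in> minimal_keys (\<chi> j. real (p j)) K" "\<kappa>' \<in> minimal_keys (\<chi> j. real (p j)) K" and j: "j \<notin> I"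
      then have K: "\<kappa> \<in> K" "\<kappa>' \<in> K" by (auto simp: minimal_keys_def)
      have "(\<chi> j. real (p j)) \<bullet> exponent \<kappa> = (\<chi> j. real (p j)) \<bullet> exponent \<kappa>'"
        using \<kappa> by (auto simp: minimal_keys_def intro: antisym)
      then have "(\<Sum>j\<in>- I. p' j * ?m \<kappa> j) = (\<Sum>j\<in>- I. p' j * ?m \<kappa>' j)"
        unfolding Pe by (simp only: of_nat_eq_iff)
      then have "\<forall>j\<in>- I. ?m \<kappa> j = ?m \<kappa>' j" by (intro p'(2) M K)
      then have "?m \<kappa> j = ?m \<kappa>' j" using j by blast
      then show "exponent \<kappa> $ j = exponent \<kappa>' $ j" by (simp only: total_exponent_def vec_lambda_beta)
    qed
  qed
qed

text \<open>Precomposing with the projection that forgets the \<open>I\<close>-coordinates turns the function on the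
  torus of \<open>- I\<close> into one on an open set of the whole space, where the open mapping theorem
  applies.\<close>

lemma open_image_of_regular_slice:
  fixes w :: "complex ^ 'n::finite"
  assumes w: "w \<in> coord_torus I"
    and nc: "\<forall>u\<in>coord_torus (- I). \<not> critical_in (- I) (\<lambda>u. key_sum c D (w + u)) u"
  shows "open ((\<lambda>u. key_sum c D (w + u)) ` coord_torus (- I))"
proof -
  define \<pi> where "\<pi> = (\<lambda>x :: complex ^ 'n. \<chi> j. if j \<in> I then 0 else x $ j)"
  define U where "U = {x :: complex ^ 'n. \<forall>j\<in>-I. x $ j \<noteq> 0}"
  define G where "G = (\<lambda>x. key_sum c D (w + \<pi> x))"
  have "linear \<pi>" by (rule linearI) (simp_all add: \<pi>_def vec_eq_iff)
  then have lin: "bounded_linear \<pi>" by (simp add: linear_conv_bounded_linear)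
  have U: "open U"
  proof -
    have "U = (\<Inter>j\<in>-I. {x. x $ j \<noteq> 0})" by (auto simp: U_def)
    then show ?thesis by (auto intro!: open_INT open_Collect_neq continuous_intros)
  qed
  have "coord_torus (- I) = \<pi> ` U"
  proof (intro equalityI subsetI)
    fix u assume "u \<in> coord_torus (- I)"
    then have "u = \<pi> u" "u \<in> U"
      by (auto simp: \<pi>_def U_def coord_torus_def coord_subspace_def vec_eq_iff)
    then show "u \<in> \<pi> ` U" by (rule image_eqI)
  qed (auto simp: \<pi>_def U_def coord_torus_def coord_subspace_def)
  then have im: "(\<lambda>u. key_sum c D (w + u)) ` coord_torus (- I) = G ` U" and
    \<pi>U: "\<And>x. x \<in> U \<Longrightarrow> \<pi> x \<in> coord_torus (- I)"
    by (auto simp: G_def image_image)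
  have "G x \<in> interior (G ` U)" if x: "x \<in> U" for x
  proof (rule interior_image_of_regular_point[OF _ _ _ U x])
    let ?z = "w + \<pi> x"
    have nz: "?z $ j \<noteq> 0" for j
      using w \<pi>U[OF x] by (cases "j \<in> I") (auto simp: coord_torus_def coord_subspace_def)
    then have z: "?z \<in> coord_torus UNIV" by (simp add: coord_torus_def coord_subspace_def)
    show "continuous_on UNIV G"
      unfolding G_def
      by (rule continuous_on_compose2[OF continuous_on_key_sum[of UNIV]])
         (rule continuous_on_add[OF continuous_on_const linear_continuous_on[OF lin]], simp)
    have "((\<lambda>x. w + \<pi> x) has_derivative \<pi>) (at x)"
      using bounded_linear_imp_has_derivative[OF lin] by (auto intro!: derivative_eq_intros)
    from has_derivative_compose[OF this has_derivative_key_sum[OF z]]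
    show D: "(G has_derivative (\<lambda>\<zeta>. key_sum_diff c D ?z (\<chi> j. \<pi> \<zeta> $ j / ?z $ j))) (at x)"
      unfolding G_def .
    show "surj (\<lambda>\<zeta>. key_sum_diff c D ?z (\<chi> j. \<pi> \<zeta> $ j / ?z $ j))"
    proof (rule surj_if_not_orthogonal)
      show "linear (\<lambda>\<zeta>. key_sum_diff c D ?z (\<chi> j. \<pi> \<zeta> $ j / ?z $ j))"
        using D by (rule has_derivative_linear)
      show "\<not> (\<exists>l. norm l = 1 \<and> (\<forall>\<zeta>. l \<bullet> key_sum_diff c D ?z (\<chi> j. \<pi> \<zeta> $ j / ?z $ j) = 0))"
      proof
        assume "\<exists>l. norm l = 1 \<and> (\<forall>\<zeta>. l \<bullet> key_sum_diff c D ?z (\<chi> j. \<pi> \<zeta> $ j / ?z $ j) = 0)"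
        then obtain l where l: "norm l = 1" "\<And>\<zeta>. l \<bullet> key_sum_diff c D ?z (\<chi> j. \<pi> \<zeta> $ j / ?z $ j) = 0" by blast
        have "l \<bullet> key_sum_diff c D ?z \<eta> = 0" if "\<eta> \<in> coord_subspace (- I)" for \<eta>
        proof -
          have "\<pi> (\<chi> j. \<eta> $ j * ?z $ j) $ j / ?z $ j = \<eta> $ j" for j
            using that nz[of j] by (cases "j \<in> I") (auto simp: \<pi>_def coord_subspace_def)
          then have "(\<chi> j. \<pi> (\<chi> j. \<eta> $ j * ?z $ j) $ j / ?z $ j) = \<eta>" by (simp add: vec_eq_iff)
          then show ?thesis using l(2)[of "\<chi> j. \<eta> $ j * ?z $ j"] by simp
        qed
        then have "critical_in (- I) (\<lambda>u. key_sum c D (w + u)) (\<pi> x)"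
          using l(1) critical_in_translate_iff[OF z] by blast
        then show False using nc \<pi>U[OF x] by blast
      qed
    qed
  qed
  then have "open (G ` U)" by (metis image_subset_iff interior_subset openI open_interior subset_antisym)
  then show ?thesis by (simp add: im)
qed

text \<open>Since the exponents outside \<open>I\<close> agree, replacing each coordinate of \<open>u\<close> by its phase changes the
  value only by a positive factor.  The directions attained are thus those attained on a
  compact torus.  If \<open>0\<close> is a value, openness of the image finishes the proof.  Otherwise the cone over the image
  is open and closed in the punctured plane.\<close>

lemma slice_attains_every_direction:
  fixes w :: "complex ^ 'n::finite" and v :: complex
  assumes w: "w \<in> coord_torus I"
    and nc: "\<forall>u\<in>coord_torus (- I). \<not> critical_in (- I) (\<lambda>u. key_sum c D (w + u)) u"
    and same: "\<forall>\<kappa>\<in>D. \<forall>\<kappa>'\<in>D. \<forall>j. j \<notin> I \<longrightarrow> exponent \<kappa> $ j = exponent \<kappa>' $ j"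
    and v: "norm v = 1"
  obtains u s where "u \<in> coord_torus (- I)" "0 < s" "key_sum c D (w + u) = of_real s * v"
proof -
  define g where "g = (\<lambda>u. key_sum c D (w + u))"
  define A where "A = g ` coord_torus (- I)"
  define T where "T = {u \<in> coord_subspace (- I). \<forall>j\<in>-I. cmod (u $ j) = 1}"
  have openA: "open A" unfolding A_def g_def by (rule open_image_of_regular_slice[OF w nc])
  have T_sub: "T \<subseteq> coord_torus (- I)"
  proof
    fix u assume u: "u \<in> T"
    have "u $ j \<noteq> 0" if "j \<in> - I" for j
      using u that by (metis (mono_tags, lifting) T_def mem_Collect_eq norm_zero zero_neq_one)
    then show "u \<in> coord_torus (- I)" using u by (simp add: T_def coord_torus_def)
  qed
  have T_ne: "T \<noteq> {}"
  proof -
    have "(\<chi> j. if j \<in> I then 0 else 1) \<in> T" by (simp add: T_def coord_subspace_def)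
    then show ?thesis by blast
  qed
  have "compact T"
  proof -
    have T_eq: "T = {u. \<forall>j. if j \<in> I then u $ j = 0 else cmod (u $ j) = 1}"
      by (auto simp: T_def coord_subspace_def)
    have "closed {u :: complex ^ 'n. if j \<in> I then u $ j = 0 else cmod (u $ j) = 1}" for j
      by (cases "j \<in> I") (auto intro!: closed_Collect_eq continuous_intros)
    then have "closed T" unfolding T_eq by (rule closed_Collect_all)
    moreover have "bounded T"
    proof -
      have "norm u \<le> CARD('n)" if "u \<in> T" for u
      proof -
        have "norm u \<le> (\<Sum>j\<in>UNIV. cmod (u $ j))" unfolding norm_vec_def by (rule L2_set_le_sum) simp
        also have "\<dots> \<le> (\<Sum>j\<in>(UNIV :: 'n set). 1)"
        proof (rule sum_mono)
          fix j show "cmod (u $ j) \<le> 1"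
            using that by (cases "j \<in> I") (auto simp: T_def coord_subspace_def)
        qed
        finally show ?thesis by simp
      qed
      then show ?thesis by (auto simp: bounded_iff)
    qed
    ultimately show ?thesis by (simp add: compact_eq_bounded_closed)
  qed
  moreover have "continuous_on T g"
    unfolding g_def by (rule continuous_on_compose2[OF continuous_on_key_sum[of UNIV]]) (auto intro!: continuous_intros)
  ultimately have cT: "compact (g ` T)" by (rule compact_continuous_image[rotated])
  have polar: "\<exists>u'\<in>T. \<exists>s>0. g u = of_real s * g u'" if u: "u \<in> coord_torus (- I)" for u
  proof -
    define u' where "u' = (\<chi> j. sgn (u $ j))"
    define q where "q = (\<chi> j. if j \<in> I then 0 else ln (cmod (u $ j)))"
    have u'T: "u' \<in> T" using u by (auto simp: T_def u'_def coord_torus_def coord_subspace_def norm_sgn)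
    have "of_real (exp (q $ j)) * (w + u') $ j = (w + u) $ j" for j
    proof (cases "j \<in> I")
      case True
      then show ?thesis using u by (simp add: q_def u'_def coord_torus_def coord_subspace_def)
    next
      case False
      then have "w $ j = 0" "u $ j \<noteq> 0" using u w by (auto simp: coord_torus_def coord_subspace_def)
      then show ?thesis using False by (simp add: q_def u'_def sgn_div_norm scaleR_conv_of_real)
    qed
    then have wu: "w + u = rescale q (w + u')" by (simp add: rescale_def vec_eq_iff)
    have eq: "q \<bullet> exponent \<kappa> = q \<bullet> exponent \<kappa>'" if "\<kappa> \<in> D" "\<kappa>' \<in> D" for \<kappa> \<kappa>'
      unfolding inner_vec_def
    proof (rule sum.cong)
      fix j
      have "exponent \<kappa> $ j = exponent \<kappa>' $ j" if "j \<notin> I"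
        using same \<open>\<kappa> \<in> D\<close> \<open>\<kappa>' \<in> D\<close> that by blast
      then show "q $ j \<bullet> exponent \<kappa> $ j = q $ j \<bullet> exponent \<kappa>' $ j"
        by (cases "j \<in> I") (simp_all add: q_def)
    qed simp
    define m where "m = q \<bullet> exponent (SOME \<kappa>. \<kappa> \<in> D)"
    have m: "q \<bullet> exponent \<kappa> = m" if "\<kappa> \<in> D" for \<kappa>
      unfolding m_def by (rule eq[OF that someI[of "\<lambda>\<kappa>. \<kappa> \<in> D", OF that]])
    have "g u = of_real (exp m) * g u'"
      unfolding g_def wu key_sum_def sum_distrib_left
      by (intro sum.cong) (simp_all add: monomial_rescale m mult_ac)
    then show ?thesis using u'T by (intro bexI[of _ u'] exI[of _ "exp m"]) auto
  qed
  have "\<exists>s>0. of_real s * v \<in> A"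
  proof (cases "0 \<in> g ` T")
    case True
    then have "0 \<in> A" using T_sub by (auto simp: A_def)
    then obtain e where e: "0 < e" "ball 0 e \<subseteq> A" using openA by (auto simp: open_contains_ball)
    then have "of_real (e / 2) * v \<in> A" using v by (intro subsetD[OF e(2)]) (simp add: norm_mult)
    then show ?thesis using e(1) by (intro exI[of _ "e / 2"]) auto
  next
    case False
    define S where "S = sgn ` g ` T"
    \<comment> \<open>This description of the cone shows closedness, its presentation as a union of dilated images
      in \<open>C_eq\<close> openness.\<close>
    define C where "C = {z :: complex. z \<in> - {0} \<and> sgn z \<in> S}"
    have contsgn: "continuous_on X sgn" if "0 \<notin> X" for X :: "complex set"
      using that by (intro continuous_on_sgn continuous_on_id) auto
    have "closed S" unfolding S_def
      using compact_continuous_image[OF contsgn[OF False] cT] by (rule compact_imp_closed)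
    then have "closedin (top_of_set (- {0})) (- {0} \<inter> sgn -` S)"
      by (intro continuous_closedin_preimage contsgn) auto
    also have "- {0} \<inter> sgn -` S = C" by (auto simp: C_def)
    finally have closedC: "closedin (top_of_set (- {0})) C" .
    have C_eq: "C = (\<Union>s\<in>{0<..}. (\<lambda>x. s *\<^sub>R x) ` A)"
    proof (intro equalityI subsetI)
      fix z assume z: "z \<in> C"
      then obtain u where u: "u \<in> T" "sgn z = sgn (g u)" "z \<noteq> 0" by (auto simp: C_def S_def)
      have "g u \<noteq> 0" using False u(1) by force
      then have "z = (norm z / norm (g u)) *\<^sub>R g u"
        using u(2,3) by (simp add: sgn_div_norm field_simps scaleR_conv_of_real)
      moreover have "0 < norm z / norm (g u)" using u(3) \<open>g u \<noteq> 0\<close> by simp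
      moreover have "g u \<in> A" using u(1) T_sub by (auto simp: A_def)
      ultimately show "z \<in> (\<Union>s\<in>{0<..}. (\<lambda>x. s *\<^sub>R x) ` A)" by blast
    next
      fix z assume "z \<in> (\<Union>s\<in>{0<..}. (\<lambda>x. s *\<^sub>R x) ` A)"
      then obtain s u where z: "0 < s" "u \<in> coord_torus (- I)" "z = s *\<^sub>R g u" by (auto simp: A_def)
      from polar[OF z(2)] obtain u' s' where u': "u' \<in> T" "0 < s'" "g u = of_real s' * g u'" by blast
      then have "z = (s * s') *\<^sub>R g u'" "0 < s * s'" using z by (simp_all add: scaleR_conv_of_real)
      moreover from this have "sgn z = sgn (g u')" by (simp add: sgn_scaleR)
      moreover have "g u' \<noteq> 0" using False u'(1) by force
      ultimately show "z \<in> C" using u'(1) by (auto simp: C_def S_def)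
    qed
    have "open C" unfolding C_eq by (intro open_UN ballI open_scaling openA) auto
    then have openC: "openin (top_of_set (- {0})) C"
      by (intro open_openin_trans) (auto simp: C_def)
    have "C \<noteq> {}"
    proof -
      obtain u where "u \<in> T" using T_ne by blast
      moreover from this have "g u \<noteq> 0" using False by force
      ultimately have "g u \<in> C" by (auto simp: C_def S_def)
      then show ?thesis by blast
    qed
    moreover have "connected (- {0 :: complex})" by (rule connected_punctured_universe) simp
    ultimately have "C = - {0}" using closedC openC by (metis connected_clopen)
    moreover have "v \<noteq> 0" using v by auto
    ultimately have "v \<in> C" by blast
    then obtain s a where sa: "0 < s" "a \<in> A" "v = s *\<^sub>R a" by (auto simp: C_eq)
    then have "of_real (inverse s) * v \<in> A" by (simp add: scaleR_conv_of_real flip: mult.assoc)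
    then show ?thesis using sa(1) by (intro exI[of _ "inverse s"]) auto
  qed
  then show ?thesis using that by (auto simp: A_def g_def)
qed

text \<open>The value of the polynomial at \<open>t\<^sup>P y\<close>, divided by \<open>t ^ d\<close>, extends to \<open>t = 0\<close> by the face function.
  Adding \<open>t\<close> to the target makes the map a submersion at \<open>(0, z)\<close>, so nearby points \<open>(t, y)\<close> with
  \<open>t > 0\<close> take the same value as the face function at \<open>z\<close>, while \<open>t\<^sup>P y\<close> stays close to \<open>w\<close>.\<close>

lemma direction_attained_near:
  fixes w :: "complex ^ 'n::finite" and p :: "'n \<Rightarrow> nat"
  defines "P \<equiv> \<chi> j. real (p j)"
  assumes fin: "finite K" "K \<noteq> {}"
    and w: "w \<in> coord_subspace {j. p j = 0}"
    and z: "z \<in> coord_torus UNIV" "\<And>j. p j = 0 \<Longrightarrow> z $ j = w $ j"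
    and val: "key_sum c (minimal_keys P K) z = of_real s * v" "0 < s"
    and nc: "\<not> critical_point (key_sum c (minimal_keys P K)) z"
    and \<epsilon>: "0 < \<epsilon>"
  obtains y s' where "y \<in> ball w \<epsilon>" "0 < s'" "key_sum c K y = of_real s' * v"
proof -
  let ?D = "minimal_keys P K"
  define n where "n = (\<lambda>\<kappa> :: (nat ^ 'n) \<times> (nat ^ 'n). \<Sum>j\<in>UNIV. p j * (fst \<kappa> $ j + snd \<kappa> $ j))"
  have Pn: "P \<bullet> exponent \<kappa> = real (n \<kappa>)" for \<kappa>
    by (simp add: P_def n_def inner_vec_def total_exponent_def)
  obtain \<kappa>\<^sub>0 where \<kappa>\<^sub>0: "\<kappa>\<^sub>0 \<in> ?D" using minimal_keys_nonempty[OF fin] by blast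
  define d where "d = n \<kappa>\<^sub>0"
  have d_le: "d \<le> n \<kappa>" if "\<kappa> \<in> K" for \<kappa>
    using \<kappa>\<^sub>0 that by (auto simp: minimal_keys_def Pn d_def)
  have D_iff: "\<kappa> \<in> ?D \<longleftrightarrow> n \<kappa> = d" if "\<kappa> \<in> K" for \<kappa>
    using \<kappa>\<^sub>0 that by (force simp: minimal_keys_def Pn d_def)
  \<comment> \<open>\<open>H (t, y)\<close> is the weighted point \<open>t\<^sup>P y\<close>, and \<open>h (t, y)\<close> the value there divided by \<open>t ^ d\<close>; at \<open>t = 0\<close>
    the convention \<open>0 ^ 0 = 1\<close> keeps exactly the minimal monomials.\<close>
  define H where "H = (\<lambda>x :: real \<times> (complex ^ 'n). \<chi> j. of_real (fst x ^ p j) * snd x $ j)"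
  define h where "h = (\<lambda>x :: real \<times> (complex ^ 'n). \<Sum>\<kappa>\<in>K. c \<kappa> * (of_real (fst x ^ (n \<kappa> - d)) * monomial \<kappa> (snd x)))"
  define G where "G = (\<lambda>x. (fst x, h x))"
  define U where "U = H -` ball w \<epsilon>"
  have "continuous_on UNIV H" unfolding H_def by (intro continuous_intros)
  then have U: "open U" unfolding U_def by (intro open_vimage) auto
  have "H (0, z) = w"
    using w z(2) by (auto simp: H_def vec_eq_iff power_0_left coord_subspace_def)
  then have zU: "(0, z) \<in> U" using \<epsilon> by (simp add: U_def)
  have h0: "h (0, y) = key_sum c ?D y" for y
    unfolding h_def key_sum_def
  proof (rule sum.mono_neutral_cong_right)
    show "?D \<subseteq> K" by (auto simp: minimal_keys_def)
    show "\<forall>\<kappa>\<in>K - ?D. c \<kappa> * (of_real (fst (0, y) ^ (n \<kappa> - d)) * monomial \<kappa> (snd (0, y))) = 0"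
      using D_iff d_le by (force simp: power_0_left)
    show "c \<kappa> * (of_real (fst (0, y) ^ (n \<kappa> - d)) * monomial \<kappa> (snd (0, y))) = c \<kappa> * monomial \<kappa> y"
      if "\<kappa> \<in> ?D" for \<kappa>
      using D_iff[of \<kappa>] that by (simp add: minimal_keys_def)
  qed (rule fin(1))
  have conth: "continuous_on UNIV h"
    unfolding h_def
    by (intro continuous_intros continuous_on_compose2[OF continuous_on_monomial[of UNIV]]) auto
  have "(\<lambda>x. monomial \<kappa> (snd x)) differentiable at (0 :: real, z)" for \<kappa>
    using has_derivative_monomial[OF z(1), of \<kappa>]
    by (intro differentiable_compose[of "monomial \<kappa>" snd] bounded_linear_imp_differentiable[OF bounded_linear_snd])
       (auto simp: differentiable_def)
  moreover have "(\<lambda>x. complex_of_real (fst x ^ k)) differentiable at (0 :: real, z)" for k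
    by (intro differentiable_compose[of complex_of_real "\<lambda>x. fst x ^ k"] differentiable_power
        bounded_linear_imp_differentiable[OF bounded_linear_fst]
        bounded_linear_imp_differentiable[OF bounded_linear_of_real])
  ultimately have "h differentiable at (0, z)"
    unfolding h_def using fin(1)
    by (intro differentiable_sum differentiable_mult differentiable_const ballI) auto
  then obtain h' where h': "(h has_derivative h') (at (0, z))" by (auto simp: differentiable_def)
  have linh: "linear h'" using h' by (rule has_derivative_linear)
  have "((\<lambda>y. (0, y)) has_derivative (\<lambda>\<zeta>. (0, \<zeta>))) (at z)"
    by (auto intro!: derivative_eq_intros)
  from has_derivative_compose[OF this h'] have "(key_sum c ?D has_derivative (\<lambda>\<zeta>. h' (0, \<zeta>))) (at z)"
    by (simp add: h0)
  then have der: "frechet_derivative (key_sum c ?D) (at z) = (\<lambda>\<zeta>. h' (0, \<zeta>))" "linear (\<lambda>\<zeta>. h' (0, \<zeta>))"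
    by (auto intro: frechet_derivative_at[symmetric] has_derivative_linear)
  have surjz: "surj (\<lambda>\<zeta>. h' (0, \<zeta>))"
    using nc der(2) low_rank_iff_orthogonal[of "\<lambda>\<zeta>. h' (0, \<zeta>)" UNIV]
    by (intro surj_if_not_orthogonal) (auto simp: critical_in_def der(1) coord_subspace_def)
  have surjG: "surj (\<lambda>x. (fst x, h' x))"
  proof (rule surjI)
    fix y :: "real \<times> complex"
    let ?\<zeta> = "inv (\<lambda>\<zeta>. h' (0, \<zeta>)) (snd y - h' (fst y, 0))"
    have "h' (fst y, ?\<zeta>) = h' (fst y, 0) + h' (0, ?\<zeta>)"
      using linear_add[OF linh, of "(fst y, 0)" "(0, ?\<zeta>)"] by simp
    also have "h' (0, ?\<zeta>) = snd y - h' (fst y, 0)" using surj_f_inv_f[OF surjz] .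
    finally show "(fst (fst y, ?\<zeta>), h' (fst y, ?\<zeta>)) = y" by simp
  qed
  have "(G has_derivative (\<lambda>x. (fst x, h' x))) (at (0, z))"
    unfolding G_def using h' by (auto intro!: derivative_eq_intros)
  moreover have "continuous_on UNIV G" unfolding G_def by (intro continuous_intros conth)
  ultimately have "G (0, z) \<in> interior (G ` U)"
    using surjG U zU by (intro interior_image_of_regular_point) auto
  then obtain e where e: "0 < e" "ball (0, of_real s * v) e \<subseteq> G ` U"
    by (auto simp: mem_interior G_def h0 val(1))
  define t where "t = e / 2"
  have t: "0 < t" using e(1) by (simp add: t_def)
  have "(t, of_real s * v) \<in> ball (0, of_real s * v) e"
    using e(1) by (simp add: t_def dist_Pair_Pair)
  then obtain y where y: "(t, y) \<in> U" "h (t, y) = of_real s * v"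
    using e(2) by (force simp: G_def)
  have "H (t, y) = rescale (ln t *\<^sub>R P) y"
    using t by (simp add: H_def rescale_def vec_eq_iff P_def exp_of_nat2_mult flip: of_real_power)
  then have mono: "monomial \<kappa> (H (t, y)) = of_real (t ^ n \<kappa>) * monomial \<kappa> y" for \<kappa>
    using t by (simp add: monomial_rescale Pn exp_of_nat2_mult)
  have "key_sum c K (H (t, y)) = of_real (t ^ d) * h (t, y)"
    unfolding key_sum_def h_def sum_distrib_left
  proof (rule sum.cong)
    fix \<kappa> assume "\<kappa> \<in> K"
    from d_le[OF this] have "t ^ n \<kappa> = t ^ d * t ^ (n \<kappa> - d)" by (simp flip: power_add)
    then show "c \<kappa> * monomial \<kappa> (H (t, y)) =
        of_real (t ^ d) * (c \<kappa> * (of_real (fst (t, y) ^ (n \<kappa> - d)) * monomial \<kappa> (snd (t, y))))"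
      by (simp add: mono)
  qed simp
  then have "key_sum c K (H (t, y)) = of_real (t ^ d * s) * v" by (simp add: y(2))
  moreover have "H (t, y) \<in> ball w \<epsilon>" using y(1) by (simp add: U_def)
  moreover have "0 < t ^ d * s" using t val(2) by simp
  ultimately show ?thesis using that by blast
qed

section \<open>Directions attained near points of the zero locus\<close>

definition attains_directions_near :: "(complex ^ 'n::finite \<Rightarrow> complex) \<Rightarrow> complex ^ 'n \<Rightarrow> bool" where
  "attains_directions_near g a \<longleftrightarrow>
     (\<forall>v \<epsilon>. norm v = 1 \<longrightarrow> 0 < \<epsilon> \<longrightarrow> (\<exists>y\<in>ball a \<epsilon>. \<exists>s>0. g y = of_real s * v))"

text \<open>A point that is regular for the face function in the directions outside \<open>I\<close> is regular in all
  directions, so a direction found on the slice through \<open>w\<close> can be transferred.\<close>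

lemma attains_directions_near_if_regular_face:
  fixes w :: "complex ^ 'n::finite" and p :: "'n \<Rightarrow> nat"
  defines "P \<equiv> \<chi> j. real (p j)"
  assumes fin: "finite K" "K \<noteq> {}"
    and p: "\<forall>j. p j = 0 \<longleftrightarrow> j \<in> I"
    and same: "\<forall>\<kappa>\<in>minimal_keys P K. \<forall>\<kappa>'\<in>minimal_keys P K. \<forall>j.
       j \<notin> I \<longrightarrow> exponent \<kappa> $ j = exponent \<kappa>' $ j"
    and w: "w \<in> coord_torus I"
    and nc: "\<forall>u\<in>coord_torus (- I). \<not> critical_in (- I) (\<lambda>u. key_sum c (minimal_keys P K) (w + u)) u"
  shows "attains_directions_near (key_sum c K) w"
  unfolding attains_directions_near_def
proof (intro allI impI)
  fix v :: complex and \<epsilon> :: real assume v: "norm v = 1" and \<epsilon>: "0 < \<epsilon>"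
  obtain u s where u: "u \<in> coord_torus (- I)" "0 < s" "key_sum c (minimal_keys P K) (w + u) = of_real s * v"
    using slice_attains_every_direction[OF w nc same v] by metis
  have "(w + u) $ j \<noteq> 0" for j
    using w u(1) by (cases "j \<in> I") (auto simp: coord_torus_def coord_subspace_def)
  then have z: "w + u \<in> coord_torus UNIV" by (simp add: coord_torus_def coord_subspace_def)
  have "critical_in (- I) (\<lambda>u. key_sum c (minimal_keys P K) (w + u)) u"
    if "critical_point (key_sum c (minimal_keys P K)) (w + u)"
    using that unfolding critical_in_translate_iff[OF z] critical_point_iff[OF z] by blast
  then have nc': "\<not> critical_point (key_sum c (minimal_keys P K)) (w + u)" using nc u(1) by blast
  have w': "w \<in> coord_subspace {j. p j = 0}" using w by (simp add: p coord_torus_def)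
  have zw: "(w + u) $ j = w $ j" if "p j = 0" for j
    using that p u(1) by (simp add: coord_torus_def coord_subspace_def)
  from direction_attained_near[OF fin w' z zw u(3)[unfolded P_def] u(2) nc'[unfolded P_def] \<epsilon>]
  show "\<exists>y\<in>ball w \<epsilon>. \<exists>s>0. key_sum c K y = of_real s * v" by metis
qed

lemma strongly_nondegenerate_positive_weight:
  assumes "f \<noteq> 0" "strongly_nondegenerate f" "\<forall>j. 0 < P $ j" "z \<in> coord_torus UNIV"
  shows "\<not> critical_point (key_sum (Poly_Mapping.lookup f) (minimal_keys P (Poly_Mapping.keys f))) z"
proof -
  have P0: "\<forall>j. 0 \<le> P $ j" using assms(3) less_imp_le by blast
  obtain \<kappa> where \<kappa>: "\<kappa> \<in> minimal_keys P (Poly_Mapping.keys f)"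
    using minimal_keys_nonempty[of "Poly_Mapping.keys f" P] assms(1) by auto
  note face = weight_face_face_of[OF P0 \<kappa>] weight_face_nonempty[OF P0 \<kappa>] compact_weight_face[OF P0 \<kappa> assms(3)]
  then have "weight_face f P \<subseteq> newton_boundary_nc f"
    by (auto simp: newton_boundary_nc_def newton_boundary_def)
  with face have "\<not> critical_point (mixed_part f (weight_face f P)) z"
    using assms(2,4) unfolding strongly_nondegenerate_def by blast
  then show ?thesis by (simp add: mixed_part_weight_face[OF P0 \<kappa>])
qed

lemma directions_near_zero:
  fixes f :: "'n::finite mixed_poly"
  assumes "f \<noteq> 0" "strongly_nondegenerate f"
  shows "attains_directions_near (mixed_eval f) 0"
proof -
  let ?K = "Poly_Mapping.keys f"
  have fin: "finite ?K" "?K \<noteq> {}" using assms(1) by auto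
  obtain p :: "'n \<Rightarrow> nat" where p: "\<forall>j. p j = 0 \<longleftrightarrow> j \<in> {}"
    "\<forall>\<kappa>\<in>minimal_keys (\<chi> j. real (p j)) ?K. \<forall>\<kappa>'\<in>minimal_keys (\<chi> j. real (p j)) ?K. \<forall>j.
       j \<notin> {} \<longrightarrow> exponent \<kappa> $ j = exponent \<kappa>' $ j"
    using adapted_weight[OF fin(1), of "{}"] by (elim exE conjE)
  have "\<forall>j. 0 < (\<chi> j. real (p j)) $ j" using p(1) by simp
  then have "\<forall>u\<in>coord_torus (- {}). \<not> critical_in (- {})
      (\<lambda>u. key_sum (Poly_Mapping.lookup f) (minimal_keys (\<chi> j. real (p j)) ?K) (0 + u)) u"
    using strongly_nondegenerate_positive_weight[OF assms] by simp
  moreover have "0 \<in> coord_torus {}" by (simp add: coord_torus_def coord_subspace_def)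
  ultimately show ?thesis
    unfolding mixed_eval_eq_key_sum by (intro attains_directions_near_if_regular_face[OF fin p])
qed

text \<open>The face of an adapted weight is essential because \<open>f\<close> vanishes on the coordinate subspace, so
  local tameness supplies the regular slices.\<close>

lemma directions_near_vanishing_subspace:
  fixes f :: "'n::finite mixed_poly"
  assumes "f \<noteq> 0" "locally_tame_along_vanishing f" "I \<in> vanishing_sets f"
  shows "\<exists>r>0. \<forall>a\<in>coord_torus I. norm a < r \<longrightarrow> attains_directions_near (mixed_eval f) a"
proof -
  let ?K = "Poly_Mapping.keys f"
  have fin: "finite ?K" "?K \<noteq> {}" using assms(1) by auto
  have I: "I \<noteq> {}" "vanishes_on f I" using assms(3) by (auto simp: vanishing_sets_def)
  obtain p :: "'n \<Rightarrow> nat" where p: "\<forall>j. p j = 0 \<longleftrightarrow> j \<in> I"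
    "\<forall>\<kappa>\<in>minimal_keys (\<chi> j. real (p j)) ?K. \<forall>\<kappa>'\<in>minimal_keys (\<chi> j. real (p j)) ?K. \<forall>j.
       j \<notin> I \<longrightarrow> exponent \<kappa> $ j = exponent \<kappa>' $ j"
    using adapted_weight[OF fin(1), of I] by (elim exE conjE)
  define P where "P = (\<chi> j. real (p j))"
  have P0: "\<forall>j. 0 \<le> P $ j" by (simp add: P_def)
  have Z: "weight_zeros P = I" by (auto simp: weight_zeros_def P_def p(1))
  obtain \<kappa> where \<kappa>: "\<kappa> \<in> minimal_keys P ?K" using minimal_keys_nonempty[OF fin] by blast
  have "essential_face f (weight_face f P) I"
    using essential_face_weight_face[OF P0 \<kappa>] I by (simp add: Z)
  then have "locally_tame_face f (weight_face f P) I"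
    using assms(2,3) by (auto simp: locally_tame_along_vanishing_def locally_tame_on_def)
  then obtain r where r: "0 < r" "\<And>w. w \<in> coord_torus I \<Longrightarrow> partial_norm_sq I w \<le> r\<^sup>2 \<Longrightarrow>
        \<forall>u\<in>coord_torus (- I). \<not> critical_in (- I) (\<lambda>u. key_sum (Poly_Mapping.lookup f) (minimal_keys P ?K) (w + u)) u"
    unfolding locally_tame_face_def mixed_part_weight_face[OF P0 \<kappa>] by blast
  have "attains_directions_near (mixed_eval f) a" if a: "a \<in> coord_torus I" "norm a < r" for a
  proof -
    have "partial_norm_sq I a \<le> (\<Sum>j\<in>UNIV. (cmod (a $ j))\<^sup>2)"
      unfolding partial_norm_sq_def by (intro sum_mono2) auto
    also have "\<dots> = (norm a)\<^sup>2" by (simp add: norm_vec_def L2_set_def sum_nonneg)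
    also have "\<dots> \<le> r\<^sup>2" using a(2) by (intro power_mono) auto
    finally show ?thesis
      unfolding mixed_eval_eq_key_sum
      by (intro attains_directions_near_if_regular_face[OF fin p a(1)] r(2)[OF a(1), unfolded P_def])
  qed
  then show ?thesis using r(1) by blast
qed

text \<open>Giving the coordinates outside \<open>I\<close> a weight larger than the minimum over \<open>K'\<close> keeps every other
  monomial out of the face.  Thus faces of the restriction to a coordinate subspace are
  faces of \<open>f\<close>, and the restriction inherits non-degeneracy.\<close>

lemma minimal_keys_extend_weight:
  fixes P :: "real ^ 'n::finite"
  assumes fin: "finite K" "K' = {\<kappa> \<in> K. \<forall>j. j \<notin> I \<longrightarrow> exponent \<kappa> $ j = 0}" "K' \<noteq> {}"
    and P: "\<forall>j. 0 < P $ j"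
  obtains Q where "\<forall>j. 0 < Q $ j" "minimal_keys Q K = minimal_keys P K'"
proof -
  have "finite K'" using fin by simp
  then obtain \<kappa>\<^sub>0 where \<kappa>\<^sub>0: "\<kappa>\<^sub>0 \<in> minimal_keys P K'" using minimal_keys_nonempty fin(3) by blast
  have e0: "0 \<le> exponent \<kappa> $ j" for \<kappa> :: "(nat ^ 'n) \<times> (nat ^ 'n)" and j by (simp add: total_exponent_def)
  define m where "m = P \<bullet> exponent \<kappa>\<^sub>0"
  have m: "0 \<le> m" unfolding m_def inner_vec_def using P e0 by (simp add: sum_nonneg less_imp_le)
  define Q where "Q = (\<chi> j. if j \<in> I then P $ j else m + 1)"
  have Q: "\<forall>j. 0 < Q $ j" using P m by (simp add: Q_def)
  have in': "Q \<bullet> exponent \<kappa> = P \<bullet> exponent \<kappa>" if "\<kappa> \<in> K'" for \<kappa>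
    unfolding inner_vec_def using that fin(2) by (intro sum.cong) (auto simp: Q_def)
  have out: "m < Q \<bullet> exponent \<kappa>" if \<kappa>: "\<kappa> \<in> K - K'" for \<kappa>
  proof -
    obtain j where j: "j \<notin> I" "exponent \<kappa> $ j \<noteq> 0" using \<kappa> fin(2) by blast
    then have "fst \<kappa> $ j + snd \<kappa> $ j \<noteq> 0" unfolding total_exponent_def by auto
    then have "1 \<le> real (fst \<kappa> $ j + snd \<kappa> $ j)" by linarith
    then have "1 \<le> exponent \<kappa> $ j" by (simp only: total_exponent_def vec_lambda_beta)
    then have "(m + 1) * 1 \<le> (m + 1) * exponent \<kappa> $ j" using m by (intro mult_left_mono) simp_all
    moreover have "Q $ j = m + 1" using j(1) by (simp add: Q_def)
    ultimately have "m < Q $ j * exponent \<kappa> $ j" by simp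
    also have "\<dots> \<le> (\<Sum>j\<in>UNIV. Q $ j * exponent \<kappa> $ j)"
      using Q e0 by (intro member_le_sum) (simp_all add: less_imp_le)
    finally show ?thesis by (simp add: inner_vec_def)
  qed
  have \<kappa>0': "\<kappa>\<^sub>0 \<in> K'" "Q \<bullet> exponent \<kappa>\<^sub>0 = m" using \<kappa>\<^sub>0 in' by (auto simp: minimal_keys_def m_def)
  have "minimal_keys Q K = minimal_keys P K'"
  proof (intro equalityI subsetI)
    fix \<kappa> assume \<kappa>: "\<kappa> \<in> minimal_keys Q K"
    have sub: "K' \<subseteq> K" using fin(2) by blast
    have le: "Q \<bullet> exponent \<kappa> \<le> Q \<bullet> exponent \<kappa>'" if "\<kappa>' \<in> K" for \<kappa>'
      using \<kappa> that by (simp only: minimal_keys_def mem_Collect_eq)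
    have "\<kappa> \<in> K" using \<kappa> by (simp only: minimal_keys_def mem_Collect_eq)
    moreover have "Q \<bullet> exponent \<kappa> \<le> m" using le[of \<kappa>\<^sub>0] \<kappa>0' sub by auto
    ultimately have K': "\<kappa> \<in> K'" using out[of \<kappa>] by fastforce
    have "P \<bullet> exponent \<kappa> \<le> P \<bullet> exponent \<kappa>'" if "\<kappa>' \<in> K'" for \<kappa>'
      using le[of \<kappa>'] sub that by (simp only: in'[OF K'] in'[OF that] subset_iff)
    then show "\<kappa> \<in> minimal_keys P K'" using K' by (simp only: minimal_keys_def mem_Collect_eq) blast
  next
    fix \<kappa> assume \<kappa>: "\<kappa> \<in> minimal_keys P K'"
    have le: "P \<bullet> exponent \<kappa> \<le> P \<bullet> exponent \<kappa>'" if "\<kappa>' \<in> K'" for \<kappa>'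
      using \<kappa> that by (simp only: minimal_keys_def mem_Collect_eq)
    have K': "\<kappa> \<in> K'" using \<kappa> by (simp only: minimal_keys_def mem_Collect_eq)
    have "Q \<bullet> exponent \<kappa> \<le> Q \<bullet> exponent \<kappa>'" if "\<kappa>' \<in> K" for \<kappa>'
    proof (cases "\<kappa>' \<in> K'")
      case True
      then show ?thesis using le by (simp only: in'[OF K'] in'[OF True])
    next
      case False
      then have "m < Q \<bullet> exponent \<kappa>'" using that out by blast
      moreover have "Q \<bullet> exponent \<kappa> \<le> m" using le[OF \<kappa>0'(1)] by (simp only: in'[OF K'] m_def)
      ultimately show ?thesis by linarith
    qed
    moreover have "\<kappa> \<in> K" using K' fin(2) by blast
    ultimately show "\<kappa> \<in> minimal_keys Q K" by (simp only: minimal_keys_def mem_Collect_eq) blast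
  qed
  then show ?thesis using Q that by blast
qed

text \<open>The monomials supported in \<open>I\<close> define a polynomial on the whole space that does not involve the
  other variables.  Setting those to a small nonzero value moves \<open>a\<close> into the full torus,
  where this polynomial has no critical point near the origin and is therefore open.  Projecting
  back to the coordinate subspace recovers values of \<open>f\<close>.\<close>

lemma directions_near_zero_on_nonvanishing_subspace:
  fixes f :: "'n::finite mixed_poly"
  assumes "f \<noteq> 0" "strongly_nondegenerate f" "\<not> vanishes_on f I"
  shows "\<exists>r>0. \<forall>a\<in>coord_torus I. norm a < r \<longrightarrow> mixed_eval f a = 0 \<longrightarrow>
           attains_directions_near (mixed_eval f) a"
proof -
  let ?K = "Poly_Mapping.keys f" and ?c = "Poly_Mapping.lookup f"
  define K' where "K' = {\<kappa> \<in> ?K. \<forall>j. j \<notin> I \<longrightarrow> exponent \<kappa> $ j = 0}"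
  have restr: "key_sum ?c K' y = mixed_eval f y" if y: "y \<in> coord_subspace I" for y
  proof -
    have "monomial \<kappa> y = 0" if \<kappa>: "\<kappa> \<in> ?K - K'" for \<kappa>
    proof -
      obtain j where j: "j \<notin> I" "exponent \<kappa> $ j \<noteq> 0" using \<kappa> unfolding K'_def by blast
      then have "y $ j = 0" "fst \<kappa> $ j \<noteq> 0 \<or> snd \<kappa> $ j \<noteq> 0"
        using y by (auto simp: coord_subspace_def total_exponent_def)
      then show ?thesis by (auto simp: mixed_monom_def)
    qed
    then show ?thesis
      unfolding mixed_eval_eq_key_sum key_sum_def
      by (intro sum.mono_neutral_left) (auto simp: K'_def)
  qed
  have K': "finite K'" "K' \<noteq> {}"
  proof -
    show "K' \<noteq> {}" using assms(3) restr by (auto simp: vanishes_on_def key_sum_def)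
  qed (simp add: K'_def)
  have "\<not> critical_point (key_sum ?c (minimal_keys P K')) z"
    if P: "\<forall>j. 0 < P $ j" and z: "z \<in> coord_torus UNIV" for P z
  proof -
    obtain Q where "\<forall>j. 0 < Q $ j" "minimal_keys Q ?K = minimal_keys P K'"
      using minimal_keys_extend_weight[OF finite_keys K'_def K'(2) P] by metis
    then show ?thesis using strongly_nondegenerate_positive_weight[OF assms(1,2)] z by metis
  qed
  then obtain r where r: "0 < r"
    "\<And>b. b \<in> coord_torus UNIV \<Longrightarrow> (\<And>j. cmod (b $ j) < r) \<Longrightarrow> \<not> critical_point (key_sum ?c K') b"
    using no_critical_point_near_zero[OF K', of ?c] by metis
  have "attains_directions_near (mixed_eval f) a"
    if a: "a \<in> coord_torus I" "norm a < r" "mixed_eval f a = 0" for a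
    unfolding attains_directions_near_def
  proof (intro allI impI)
    fix v :: complex and \<epsilon> :: real assume v: "norm v = 1" and \<epsilon>: "0 < \<epsilon>"
    define \<pi> where "\<pi> = (\<lambda>x :: complex ^ 'n. \<chi> j. if j \<in> I then x $ j else 0)"
    define b where "b = (\<chi> j. if j \<in> I then a $ j else of_real (r / 2))"
    have \<pi>b: "\<pi> b = a" using a(1) by (auto simp: \<pi>_def b_def vec_eq_iff coord_torus_def coord_subspace_def)
    have \<pi>_key: "key_sum ?c K' (\<pi> x) = key_sum ?c K' x" for x
      by (rule key_sum_cong) (auto simp: K'_def \<pi>_def split: if_splits)
    have \<pi>_in: "\<pi> x \<in> coord_subspace I" for x by (simp add: \<pi>_def coord_subspace_def)
    have b: "b \<in> coord_torus UNIV"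
      using a(1) r(1) by (auto simp: b_def coord_torus_def coord_subspace_def)
    have "cmod (b $ j) < r" for j
      using Finite_Cartesian_Product.norm_nth_le[of a j] a(2) r(1) by (auto simp: b_def)
    then have nc: "\<not> critical_point (key_sum ?c K') b" using r(2)[OF b] by blast
    have "continuous_on UNIV \<pi>"
      unfolding \<pi>_def
    proof (rule continuous_on_vec_lambda)
      show "continuous_on UNIV (\<lambda>x. if j \<in> I then x $ j else 0)" for j
        by (cases "j \<in> I") (auto intro!: continuous_intros)
    qed
    then have U: "open (\<pi> -` ball a \<epsilon>)" by (rule open_vimage[rotated]) simp
    let ?F = "\<lambda>\<zeta>. key_sum_diff ?c K' b (\<chi> j. \<zeta> $ j / b $ j)"
    have D: "(key_sum ?c K' has_derivative ?F) (at b)" by (rule has_derivative_key_sum[OF b])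
    then have fd: "frechet_derivative (key_sum ?c K') (at b) = ?F"
      by (rule frechet_derivative_at[symmetric])
    have "surj ?F"
    proof (rule surj_if_not_orthogonal)
      show "linear ?F" using D by (rule has_derivative_linear)
      show "\<not> (\<exists>l. norm l = 1 \<and> (\<forall>\<zeta>. l \<bullet> ?F \<zeta> = 0))"
        using nc low_rank_iff_orthogonal[of ?F UNIV]
        by (simp add: critical_in_def fd coord_subspace_def)
    qed
    then have "key_sum ?c K' b \<in> interior (key_sum ?c K' ` (\<pi> -` ball a \<epsilon>))"
      by (intro interior_image_of_regular_point[OF continuous_on_key_sum D _ U]) (simp_all add: \<pi>b \<epsilon>)
    moreover have "key_sum ?c K' b = 0"
      using \<pi>_key[of b] restr[OF \<pi>_in[of b]] a(3) by (simp add: \<pi>b)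
    ultimately obtain e where e: "0 < e" "ball 0 e \<subseteq> key_sum ?c K' ` (\<pi> -` ball a \<epsilon>)"
      by (auto simp: mem_interior)
    have "of_real (e / 2) * v \<in> ball 0 e" using e(1) v by (simp add: norm_mult)
    then obtain x where x: "\<pi> x \<in> ball a \<epsilon>" "key_sum ?c K' x = of_real (e / 2) * v"
      using e(2) by fastforce
    then have "mixed_eval f (\<pi> x) = of_real (e / 2) * v"
      using restr[OF \<pi>_in[of x]] \<pi>_key[of x] by simp
    then show "\<exists>y\<in>ball a \<epsilon>. \<exists>s>0. mixed_eval f y = of_real s * v"
      using x(1) e(1) half_gt_zero by blast
  qed
  then show ?thesis using r(1) by blast
qed

theorem lemma14:
  fixes f :: "'n::finite mixed_poly"
  assumes "f \<noteq> 0"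
    and "strongly_nondegenerate f"
    and "locally_tame_along_vanishing f"
  shows "stable_boundary_condition f"
proof -
  have "\<exists>r>0. \<forall>a\<in>coord_torus I. norm a < r \<longrightarrow> mixed_eval f a = 0 \<longrightarrow>
      attains_directions_near (mixed_eval f) a" for I :: "'n set"
  proof -
    consider "I = {}" | "I \<in> vanishing_sets f" | "\<not> vanishes_on f I"
      unfolding vanishing_sets_def by blast
    then show ?thesis
    proof cases
      case 1
      then have "coord_torus I = {0}"
        by (auto simp: coord_torus_def coord_subspace_def vec_eq_iff)
      then show ?thesis
        using directions_near_zero[OF assms(1,2)] by (intro exI[of _ 1]) simp
    next
      case 2
      then show ?thesis using directions_near_vanishing_subspace[OF assms(1,3)] by blast
    next
      case 3
      then show ?thesis using directions_near_zero_on_nonvanishing_subspace[OF assms(1,2)] by blast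
    qed
  qed
  then have "\<forall>I :: 'n set. \<exists>r. 0 < r \<and> (\<forall>a\<in>coord_torus I. norm a < r \<longrightarrow>
      mixed_eval f a = 0 \<longrightarrow> attains_directions_near (mixed_eval f) a)" by blast
  from choice[OF this] obtain R :: "'n set \<Rightarrow> real" where R: "\<And>I. 0 < R I"
    "\<And>I a. a \<in> coord_torus I \<Longrightarrow> norm a < R I \<Longrightarrow> mixed_eval f a = 0 \<Longrightarrow>
        attains_directions_near (mixed_eval f) a"
    by blast
  define r\<^sub>0 where "r\<^sub>0 = Min (range R)"
  have r0: "0 < r\<^sub>0" "\<And>I. r\<^sub>0 \<le> R I" using R(1) by (auto simp: r\<^sub>0_def)
  have "a \<in> closure (milnor_fiber f \<theta> r)"
    if r: "0 < r" "r \<le> r\<^sub>0" and a: "a \<in> zero_locus f \<inter> ball 0 r" for r \<theta> a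
    unfolding closure_approachable
  proof (intro allI impI)
    fix e :: real assume e: "0 < e"
    have "norm a < r" using a by simp
    moreover have "a \<in> coord_torus {j. a $ j \<noteq> 0}" by (simp add: coord_torus_def coord_subspace_def)
    ultimately have att: "attains_directions_near (mixed_eval f) a"
      using R(2)[of a "{j. a $ j \<noteq> 0}"] r0(2)[of "{j. a $ j \<noteq> 0}"] r(2) a by (simp add: zero_locus_def)
    define \<epsilon> where "\<epsilon> = min e (r - norm a)"
    have "0 < \<epsilon>" using e \<open>norm a < r\<close> by (simp add: \<epsilon>_def)
    then obtain y s where y: "y \<in> ball a \<epsilon>" "0 < s"
      "mixed_eval f y = of_real s * exp (\<i> * complex_of_real \<theta>)"
      using att unfolding attains_directions_near_def by (metis norm_exp_i_times)
    have "dist y a < e" "norm y < r"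
      using y(1) norm_triangle_sub[of y a] by (auto simp: \<epsilon>_def dist_norm norm_minus_commute)
    moreover have "cmod (mixed_eval f y) = s" using y(2,3) by (simp add: norm_mult)
    then have "mixed_eval f y \<noteq> 0"
      "mixed_eval f y / complex_of_real (cmod (mixed_eval f y)) = exp (\<i> * complex_of_real \<theta>)"
      using y(2,3) by auto
    ultimately show "\<exists>y\<in>milnor_fiber f \<theta> r. dist y a < e"
      by (intro bexI[of _ y]) (auto simp: milnor_fiber_def zero_locus_def)
  qed
  then show ?thesis unfolding stable_boundary_condition_def using r0(1) by blast
qed

end
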